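(* Let $f:\{0,1\}^*\to\{0,1\}^*$ be a length-preserving permutation that can be computed by polynomial-size quantum circuits. Suppose that for any polynomial $p$ and infinitely many (even) $n$ there exist a polynomial $r_p(n)\ge n$ and an $r_p(n)$-qubit $(1/2^{p(n)},1/p(n))$-pseudo identity operator $J_n$ such that the family of unitary operators $$\mathcal F_{n,p}(f)=\{\tilde Q_j(f)\}=\Big\{(I_n\otimes J_n)^{\dagger}\,\big(Q_j(f)\otimes I_{r_p(n)-n}\big)\,(I_n\otimes J_n)\Big\}_{j=0,1,\dots,\frac n2-1}$$ is easy. (Explicitly: for every polynomial $p$ there are polynomials $r_p$, with $r_p(n)\ge n$, and $s_p$ such that for infinitely many even $n$ there is an $r_p(n)$-qubit $(1/2^{p(n)},1/p(n))$-pseudo identity operator $J_n$ for which every operator in $\mathcal F_{n,p}(f)$ is implemented by a quantum circuit of size at most $s_p(n)$.) Then $f$ is not weakly quantum one-way.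
   Context: Polynomials are taken to have positive integer values. Quantum circuits are (possibly non-uniform) sequences of elementary one- and two-qubit gates, size being the number of gates. A unitary on $n$ qubits (a family indexed by $n$) is easy if it is implemented by quantum circuits of size polynomial in $n$; a set of unitaries is easy if all its members are. $I_k$ is the identity on $k$ qubits. The parameter $n$ indexing the families of operators is even. A function $f:\{0,1\}^*\to\{0,1\}^*$ is a length-preserving permutation if for each $n$ it restricts to a bijection of $\{0,1\}^n$. For a bit string $y$, $y_{(i,j)}$ is the substring from the $i$-th to the $j$-th bit (bits numbered from $1$; $y_{(1,0)}$ is the empty string). Weakly quantum one-way: a length-preserving permutation $f$ is weakly quantum one-way if (i) $f$ can be computed by polynomial-size quantum circuits (with classical outputs on classical inputs), and (ii) there is a polynomial $p$ such that for every polynomial-size quantum circuit (family) $A$ and all sufficiently large $n$, $\Pr[A(f(U_n))\ne U_n]>1/p(n)$, where $U_n$ is uniform over $\{0,1\}^n$ (both occurrences denote the same sample) and the probability is also over the measurement outcome of $A$. Reflection operators: for even $n$ and $0\le j\le n/2-1$, $Q_j(f)$ is the unitary on two $n$-qubit registers $$Q_j(f)=\sum_{x\in\{0,1\}^n}|x\rangle\langle x|\otimes\big(2|\psi_{j,x}\rangle\langle\psi_{j,x}|-I\big),\qquad |\psi_{j,x}\rangle=\frac1{\sqrt{2^{n-2j}}}\sum_{y\in\{0,1\}^n:\ f(y)_{(1,2j)}=x_{(1,2j)}}|y\rangle .$$ Pseudo identity: let $d(n)\ge n$ be a polynomial. A $d(n)$-qubit unitary $J_n$ is an $(a(n),b(n))$-pseudo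 identity operator if there is a set $X_n\subseteq\{0,1\}^n$ with $|X_n|/2^n\le b(n)$ such that for every $z\in\{0,1\}^n\setminus X_n$, $\big|1-(\langle z|_1\langle 0|_2)J_n(|z\rangle_1|0\rangle_2)\big|\le a(n)$, where $|z\rangle_1$ is an $n$-qubit computational basis state and $|0\rangle_2$ is the all-zero state of $d(n)-n$ ancilla qubits. $J_n$ itself is not required to be easy. Registers: the operators in $\mathcal F_{n,p}(f)$ act on three registers of $n$, $n$ and $r_p(n)-n$ qubits; $I_n\otimes J_n$ applies $J_n$ to the second and third registers, and $Q_j(f)\otimes I_{r_p(n)-n}$ applies $Q_j(f)$ to the first and second. *)

theory Defs
  imports Complex_Main "HOL-Computational_Algebra.Polynomial"
begin

text \<open>
  Polynomials with positive integer values. Only arguments \<open>n \<ge> 1\<close> are constrained, so that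
  for instance \<open>\<lambda>n. n\<close> qualifies; the value at \<open>0\<close> is arbitrary.
\<close>

definition pos_polynomial :: "(nat \<Rightarrow> nat) \<Rightarrow> bool" where
  "pos_polynomial p \<longleftrightarrow>
     (\<exists>q :: real poly. \<forall>n\<ge>1. 0 < p n \<and> real (p n) = poly q (real n))"

definition bitstrings :: "nat \<Rightarrow> bool list set" where
  "bitstrings n = {x. length x = n}"

definition length_preserving_permutation :: "(bool list \<Rightarrow> bool list) \<Rightarrow> bool" where
  "length_preserving_permutation f \<longleftrightarrow> (\<forall>n. bij_betw f (bitstrings n) (bitstrings n))"


section \<open>Operators on qubits\<close>

text \<open>
  An \<open>n\<close>-qubit state is a family of amplitudes indexed by \<^term>\<open>bitstrings n\<close>, and an
  \<open>n\<close>-qubit operator \<open>U\<close> is given by its matrix entries \<open>U x y = \<langle>x|U|y\<rangle>\<close> for \<open>x\<close>, \<open>y\<close> in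
  \<^term>\<open>bitstrings n\<close>. Values at strings of any other length are irrelevant, so equality of
  \<open>n\<close>-qubit operators is \<open>op_eq n\<close>.
\<close>

type_synonym state = "bool list \<Rightarrow> complex"
type_synonym qop = "bool list \<Rightarrow> bool list \<Rightarrow> complex"

definition ket :: "bool list \<Rightarrow> state" where
  "ket x = (\<lambda>y. of_bool (x = y))"

definition op_id :: qop where
  "op_id = (\<lambda>x y. of_bool (x = y))"

definition op_mult :: "nat \<Rightarrow> qop \<Rightarrow> qop \<Rightarrow> qop" where
  "op_mult n U V = (\<lambda>x y. \<Sum>z\<in>bitstrings n. U x z * V z y)"

definition op_adj :: "qop \<Rightarrow> qop" where
  "op_adj U = (\<lambda>x y. cnj (U y x))"

definition op_eq :: "nat \<Rightarrow> qop \<Rightarrow> qop \<Rightarrow> bool" where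
  "op_eq n U V \<longleftrightarrow> (\<forall>x\<in>bitstrings n. \<forall>y\<in>bitstrings n. U x y = V x y)"

definition op_unitary :: "nat \<Rightarrow> qop \<Rightarrow> bool" where
  "op_unitary n U \<longleftrightarrow>
     op_eq n (op_mult n (op_adj U) U) op_id \<and> op_eq n (op_mult n U (op_adj U)) op_id"

text \<open>\<open>|\<psi>\<rangle>\<langle>\<phi>|\<close>\<close>

definition outer :: "state \<Rightarrow> state \<Rightarrow> qop" where
  "outer \<psi> \<phi> = (\<lambda>x y. \<psi> x * cnj (\<phi> y))"

text \<open>\<open>U \<otimes> V\<close>, where \<open>U\<close> acts on the first \<open>a\<close> qubits and \<open>V\<close> on the remaining ones.\<close>

definition op_tensor :: "nat \<Rightarrow> qop \<Rightarrow> qop \<Rightarrow> qop" where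
  "op_tensor a U V = (\<lambda>x y. U (take a x) (take a y) * V (drop a x) (drop a y))"


section \<open>Quantum circuits\<close>

text \<open>
  A gate \<open>(ws, U)\<close> applies the one- or two-qubit unitary \<open>U\<close> to the wires listed in \<open>ws\<close>, in that
  order. Wires are numbered from \<open>0\<close>.
\<close>

type_synonym gate = "nat list \<times> qop"

definition valid_gate :: "nat \<Rightarrow> gate \<Rightarrow> bool" where
  "valid_gate N g \<longleftrightarrow> (case g of (ws, U) \<Rightarrow>
     length ws \<in> {1, 2} \<and> distinct ws \<and> set ws \<subseteq> {..<N} \<and> op_unitary (length ws) U)"

definition gate_op :: "nat \<Rightarrow> gate \<Rightarrow> qop" where
  "gate_op N g = (case g of (ws, U) \<Rightarrow> (\<lambda>x y.
     if \<forall>i<N. i \<notin> set ws \<longrightarrow> x ! i = y ! i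
     then U (map ((!) x) ws) (map ((!) y) ws) else 0))"

text \<open>The head of the gate list is applied first; the size of a circuit is the length of the list.\<close>

fun circuit_op :: "nat \<Rightarrow> gate list \<Rightarrow> qop" where
  "circuit_op N [] = op_id"
| "circuit_op N (g # gs) = op_mult N (circuit_op N gs) (gate_op N g)"

definition valid_circuit :: "nat \<Rightarrow> gate list \<Rightarrow> bool" where
  "valid_circuit N gs \<longleftrightarrow> (\<forall>g\<in>set gs. valid_gate N g)"

abbreviation zeros :: "nat \<Rightarrow> bool list" where
  "zeros m \<equiv> replicate m False"

text \<open>
  The circuit may use any number \<open>m\<close> of work qubits, which start in the all-zero state and are
  returned to it: \<open>C (|x\<rangle> \<otimes> |0\<rangle>) = (U |x\<rangle>) \<otimes> |0\<rangle>\<close> for every basis state \<open>x\<close> of the \<open>k\<close> qubits on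
  which \<open>U\<close> acts. The implementation is exact.
\<close>

definition implements :: "nat \<Rightarrow> gate list \<Rightarrow> qop \<Rightarrow> bool" where
  "implements k C U \<longleftrightarrow> (\<exists>m. valid_circuit (k + m) C \<and>
     (\<forall>x\<in>bitstrings k. \<forall>y\<in>bitstrings (k + m).
        circuit_op (k + m) C y (x @ zeros m) = U (take k y) x * ket (zeros m) (drop k y)))"

text \<open>
  A family assigns to each input length \<open>n\<close> a number \<open>m\<close> of work qubits and a circuit on \<open>n + m\<close>
  wires. The input is placed on the first \<open>n\<close> wires, the work qubits start in the all-zero state,
  and the output is obtained by measuring the first \<open>n\<close> wires at the end.
\<close>

type_synonym circuit_family = "nat \<Rightarrow> nat \<times> gate list"

definition poly_size_family :: "circuit_family \<Rightarrow> bool" where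
  "poly_size_family A \<longleftrightarrow> (\<exists>s. pos_polynomial s \<and>
     (\<forall>n. valid_circuit (n + fst (A n)) (snd (A n)) \<and> length (snd (A n)) \<le> s n))"

text \<open>The probability that the family \<open>A\<close>, run on input \<open>x\<close> of length \<open>n\<close>, outputs \<open>y\<close>.\<close>

definition output_prob :: "circuit_family \<Rightarrow> nat \<Rightarrow> bool list \<Rightarrow> bool list \<Rightarrow> real" where
  "output_prob A n x y = (case A n of (m, C) \<Rightarrow>
     \<Sum>w\<in>bitstrings m. (cmod (circuit_op (n + m) C (y @ w) (x @ zeros m)))\<^sup>2)"

text \<open>Outputs on classical inputs are classical, i.e. the output is \<open>f x\<close> with certainty.\<close>

definition poly_size_computable :: "(bool list \<Rightarrow> bool list) \<Rightarrow> bool" where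
  "poly_size_computable f \<longleftrightarrow> (\<exists>A. poly_size_family A \<and>
     (\<forall>n. \<forall>x\<in>bitstrings n. output_prob A n x (f x) = 1))"

text \<open>\<open>Pr[A(f(U\<^sub>n)) \<noteq> U\<^sub>n]\<close> for \<open>U\<^sub>n\<close> uniform on \<^term>\<open>bitstrings n\<close>.\<close>

definition inversion_failure_prob :: "circuit_family \<Rightarrow> (bool list \<Rightarrow> bool list) \<Rightarrow> nat \<Rightarrow> real" where
  "inversion_failure_prob A f n =
     (\<Sum>x\<in>bitstrings n. \<Sum>y\<in>bitstrings n - {x}. output_prob A n (f x) y) / 2 ^ n"

text \<open>To be used for length-preserving permutations only.\<close>

definition weakly_quantum_one_way :: "(bool list \<Rightarrow> bool list) \<Rightarrow> bool" where
  "weakly_quantum_one_way f \<longleftrightarrow> poly_size_computable f \<and>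
     (\<exists>p. pos_polynomial p \<and>
       (\<forall>A. poly_size_family A \<longrightarrow>
         (\<forall>\<^sub>F n in sequentially. inversion_failure_prob A f n > 1 / real (p n))))"


section \<open>Reflections and pseudo identities\<close>

text \<open>The substring \<open>y\<^bsub>(1,2j)\<^esub>\<close> is \<^term>\<open>take (2 * j) y\<close>.\<close>

definition prefix_state :: "(bool list \<Rightarrow> bool list) \<Rightarrow> nat \<Rightarrow> nat \<Rightarrow> bool list \<Rightarrow> state" where
  "prefix_state f n j x = (\<lambda>u. complex_of_real (1 / sqrt (2 ^ (n - 2 * j))) *
     (\<Sum>y\<in>{y \<in> bitstrings n. take (2 * j) (f y) = take (2 * j) x}. ket y u))"

definition reflection_op :: "(bool list \<Rightarrow> bool list) \<Rightarrow> nat \<Rightarrow> nat \<Rightarrow> qop" where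
  "reflection_op f n j = (\<lambda>u v. \<Sum>x\<in>bitstrings n.
     op_tensor n (outer (ket x) (ket x))
       (\<lambda>y z. 2 * outer (prefix_state f n j x) (prefix_state f n j x) y z - op_id y z) u v)"

definition pseudo_identity :: "nat \<Rightarrow> nat \<Rightarrow> real \<Rightarrow> real \<Rightarrow> qop \<Rightarrow> bool" where
  "pseudo_identity n d a b J \<longleftrightarrow> n \<le> d \<and> op_unitary d J \<and>
     (\<exists>X\<subseteq>bitstrings n. real (card X) / 2 ^ n \<le> b \<and>
       (\<forall>z\<in>bitstrings n - X. cmod (1 - J (z @ zeros (d - n)) (z @ zeros (d - n))) \<le> a))"

text \<open>\<open>(I\<^sub>n \<otimes> J)\<^sup>\<dagger> (Q\<^sub>j(f) \<otimes> I\<^bsub>r-n\<^esub>) (I\<^sub>n \<otimes> J)\<close> on \<open>n + r\<close> qubits, where \<open>J\<close> acts on \<open>r\<close> qubits.\<close>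

definition conj_reflection_op ::
    "(bool list \<Rightarrow> bool list) \<Rightarrow> nat \<Rightarrow> nat \<Rightarrow> qop \<Rightarrow> nat \<Rightarrow> qop" where
  "conj_reflection_op f n r J j =
     op_mult (n + r) (op_adj (op_tensor n op_id J))
       (op_mult (n + r) (op_tensor (2 * n) (reflection_op f n j) op_id) (op_tensor n op_id J))"

end

theory Submission
  imports Defs "HOL-Analysis.L2_Norm" "HOL-Analysis.Convex"
begin

text \<open>
  Let \<open>|\<psi>\<^sub>j\<rangle>\<close> be the uniform superposition of the strings \<open>y\<close> for which \<open>f y\<close> agrees with the
  input \<open>x\<close> on the first \<open>2j\<close> bits. The strings that agree on the next two bits as well make up
  a quarter of it, so flipping their sign and applying \<open>Q\<^sub>j(f)\<close> is a Grover iteration that maps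
  \<open>|\<psi>\<^sub>j\<rangle>\<close> exactly to \<open>|\<psi>\<^sub>j\<^sub>+\<^sub>1\<rangle>\<close>; after \<open>n/2\<close> iterations only \<open>f\<^sup>-\<^sup>1(x)\<close> is left. Replacing
  \<open>Q\<^sub>j(f)\<close> by its conjugate costs, in each iteration, the deviation of \<open>J\<close> from the identity on
  \<open>|\<psi>\<^sub>j\<rangle>\<close> and \<open>|\<psi>\<^sub>j\<^sub>+\<^sub>1\<rangle>\<close>. Its square is at most \<open>4a 4\<^sup>n\<close> plus eight times the weight of the
  exceptional set \<open>X\<close> in the state, and averaged over \<open>x\<close> this weight is \<open>|X| / 2\<^sup>n\<close>. By
  Cauchy-Schwarz over the iterations the average failure probability is at most
  \<open>n\<^sup>2(4a 4\<^sup>n + 8b)\<close>, which a large enough \<open>p\<close> makes smaller than any inverse polynomial.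
\<close>

text \<open>\<open>J\<close> itself may be hard to implement, so it can be neither applied nor
  undone; each product \<open>J\<^sup>\<dagger> Q J\<close> has to stand in for \<open>Q\<close> as
  it is. For a single input this may fail badly: in late iterations
  \<open>|\<psi>\<^sub>j\<rangle>\<close> is spread over a few strings, all of which may lie in
  \<open>X\<close>. But for fixed \<open>u\<close> and \<open>j\<close> the weights of
  \<open>u\<close> in the states \<open>|\<psi>\<^sub>j\<rangle>\<close> sum to 1 over all inputs,
  so on average every iteration sees \<open>X\<close> with its uniform density, and the failure
  probability is an average too. Off \<open>X\<close> only diagonal entries of \<open>J\<close> are
  controlled; as \<open>J\<close> preserves norms, this bounds the off-diagonal part as well. The
  factor \<open>4\<^sup>n\<close> is the price of a triangle inequality over all basis states, paid
  for by the choice of \<open>p\<close> in \<open>a = 1 / 2 ^ p n\<close>. The sign flip has to be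
  built from a circuit for \<open>f\<close> that may leave garbage behind. Good lengths occur only
  infinitely often; this is enough, because one-wayness speaks about all sufficiently large
  \<open>n\<close>.\<close>

section \<open>Bit strings and sums over concatenated registers\<close>

lemma finite_bitstrings [simp]: "finite (bitstrings n)"
  using finite_lists_length_eq[of "UNIV :: bool set" n] by (simp add: bitstrings_def)

lemma card_bitstrings: "card (bitstrings n) = 2 ^ n"
  using card_lists_length_eq[of "UNIV :: bool set" n] by (simp add: bitstrings_def)

lemma append_in_bitstrings [simp]:
  "u \<in> bitstrings a \<Longrightarrow> w \<in> bitstrings b \<Longrightarrow> u @ w \<in> bitstrings (a + b)"
  by (simp add: bitstrings_def)

lemma zeros_in_bitstrings [simp]: "zeros m \<in> bitstrings m"
  by (simp add: bitstrings_def)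

lemma bitstrings_add:
  "bitstrings (a + b) = (\<lambda>(u, w). u @ w) ` (bitstrings a \<times> bitstrings b)"
proof (intro equalityI subsetI)
  fix x assume "x \<in> bitstrings (a + b)"
  then have "x = (\<lambda>(u, w). u @ w) (take a x, drop a x)"
    "(take a x, drop a x) \<in> bitstrings a \<times> bitstrings b"
    by (auto simp: bitstrings_def)
  then show "x \<in> (\<lambda>(u, w). u @ w) ` (bitstrings a \<times> bitstrings b)" by (rule image_eqI)
qed auto

lemma sum_bitstrings_add:
  "(\<Sum>x\<in>bitstrings (a + b). h x) = (\<Sum>u\<in>bitstrings a. \<Sum>w\<in>bitstrings b. h (u @ w))"
proof -
  have "inj_on (\<lambda>(u, w). u @ w) (bitstrings a \<times> bitstrings b)"
    by (auto simp: inj_on_def bitstrings_def)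
  then show ?thesis
    by (simp add: bitstrings_add sum.reindex sum.cartesian_product case_prod_unfold)
qed

lemma bitstrings_addE:
  assumes "x \<in> bitstrings (a + b)"
  obtains u w where "x = u @ w" "u \<in> bitstrings a" "w \<in> bitstrings b"
  using assms by (auto simp: bitstrings_add)


section \<open>Operators\<close>

lemma op_mult_assoc: "op_mult N (op_mult N U V) W = op_mult N U (op_mult N V W)"
proof (intro ext)
  fix x y
  have "op_mult N (op_mult N U V) W x y
      = (\<Sum>z\<in>bitstrings N. \<Sum>w\<in>bitstrings N. U x w * V w z * W z y)"
    by (simp add: op_mult_def sum_distrib_right)
  also have "\<dots> = (\<Sum>w\<in>bitstrings N. \<Sum>z\<in>bitstrings N. U x w * V w z * W z y)"
    by (rule sum.swap)
  also have "\<dots> = op_mult N U (op_mult N V W) x y"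
    by (simp add: op_mult_def sum_distrib_left mult.assoc)
  finally show "op_mult N (op_mult N U V) W x y = op_mult N U (op_mult N V W) x y" .
qed

lemma op_adj_mult: "op_adj (op_mult N U V) = op_mult N (op_adj V) (op_adj U)"
  by (intro ext) (simp add: op_mult_def op_adj_def mult.commute)

lemma op_adj_adj [simp]: "op_adj (op_adj U) = U"
  by (simp add: op_adj_def)

lemma op_mult_id_left: "x \<in> bitstrings N \<Longrightarrow> op_mult N op_id U x y = U x y"
  by (simp add: op_mult_def op_id_def of_bool_def if_distrib if_distribR cong: if_cong)

lemma op_mult_id_right: "y \<in> bitstrings N \<Longrightarrow> op_mult N U op_id x y = U x y"
  by (simp add: op_mult_def op_id_def of_bool_def if_distrib if_distribR cong: if_cong)

lemma op_eqI: "(\<And>x y. x \<in> bitstrings N \<Longrightarrow> y \<in> bitstrings N \<Longrightarrow> U x y = V x y) \<Longrightarrow> op_eq N U V"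
  by (simp add: op_eq_def)

lemma op_mult_cong:
  assumes "\<And>z. z \<in> bitstrings N \<Longrightarrow> U x z = U' x z" "\<And>z. z \<in> bitstrings N \<Longrightarrow> V z y = V' z y"
  shows "op_mult N U V x y = op_mult N U' V' x y"
  using assms by (simp add: op_mult_def)

text \<open>One half of \<open>op_unitary\<close>, namely \<open>U\<^sup>\<dagger> U = I\<close>: it
  gives norm preservation and can be read off any circuit that implements \<open>U\<close> with work
  qubits.\<close>

definition op_isometry :: "nat \<Rightarrow> qop \<Rightarrow> bool" where
  "op_isometry N U \<longleftrightarrow> op_eq N (op_mult N (op_adj U) U) op_id"

lemma op_isometry_mult:
  assumes "op_isometry N U" "op_isometry N V"
  shows "op_isometry N (op_mult N U V)"
  unfolding op_isometry_def
proof (rule op_eqI)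
  fix x y assume xy: "x \<in> bitstrings N" "y \<in> bitstrings N"
  have "op_mult N (op_adj (op_mult N U V)) (op_mult N U V) x y
      = op_mult N (op_adj V) (op_mult N (op_mult N (op_adj U) U) V) x y"
    by (simp add: op_adj_mult op_mult_assoc)
  also have "\<dots> = op_mult N (op_adj V) V x y"
  proof (rule op_mult_cong)
    fix z assume z: "z \<in> bitstrings N"
    have "op_mult N (op_mult N (op_adj U) U) V z y = op_mult N op_id V z y"
      using assms(1) z by (intro op_mult_cong) (auto simp: op_isometry_def op_eq_def)
    then show "op_mult N (op_mult N (op_adj U) U) V z y = V z y"
      using z by (simp add: op_mult_id_left)
  qed simp
  finally show "op_mult N (op_adj (op_mult N U V)) (op_mult N U V) x y = op_id x y"
    using assms(2) xy by (simp add: op_isometry_def op_eq_def)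
qed

lemma op_isometry_id: "op_isometry N op_id"
proof -
  have "op_adj op_id = op_id" by (auto simp: op_adj_def op_id_def fun_eq_iff)
  then show ?thesis by (auto simp: op_isometry_def op_eq_def op_mult_id_left)
qed

section \<open>Action on states and the Euclidean norm\<close>

definition op_app :: "nat \<Rightarrow> qop \<Rightarrow> state \<Rightarrow> state" where
  "op_app N U v = (\<lambda>y. \<Sum>z\<in>bitstrings N. U y z * v z)"

lemma op_app_mult: "op_app N (op_mult N U V) v = op_app N U (op_app N V v)"
proof (intro ext)
  fix y
  have "op_app N (op_mult N U V) v y
      = (\<Sum>z\<in>bitstrings N. \<Sum>w\<in>bitstrings N. U y w * V w z * v z)"
    by (simp add: op_app_def op_mult_def sum_distrib_right)
  also have "\<dots> = (\<Sum>w\<in>bitstrings N. \<Sum>z\<in>bitstrings N. U y w * V w z * v z)"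
    by (rule sum.swap)
  also have "\<dots> = op_app N U (op_app N V v) y"
    by (simp add: op_app_def sum_distrib_left mult.assoc)
  finally show "op_app N (op_mult N U V) v y = op_app N U (op_app N V v) y" .
qed

lemma op_app_diff: "op_app N U (\<lambda>z. v z - w z) = (\<lambda>z. op_app N U v z - op_app N U w z)"
  by (simp add: op_app_def right_diff_distrib sum_subtractf)

lemma op_app_cong: "(\<And>z. z \<in> bitstrings N \<Longrightarrow> v z = w z) \<Longrightarrow> op_app N U v = op_app N U w"
  by (simp add: op_app_def)

lemma op_app_ket: "x \<in> bitstrings N \<Longrightarrow> op_app N U (ket x) y = U y x"
  by (simp add: op_app_def ket_def of_bool_def if_distrib if_distribR cong: if_cong)

definition qnorm :: "nat \<Rightarrow> state \<Rightarrow> real" where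
  "qnorm N v = L2_set (\<lambda>z. cmod (v z)) (bitstrings N)"

lemma qnorm_nonneg [simp]: "0 \<le> qnorm N v"
  by (simp add: qnorm_def)

lemma qnorm_power2: "(qnorm N v)\<^sup>2 = (\<Sum>z\<in>bitstrings N. (cmod (v z))\<^sup>2)"
  by (simp add: qnorm_def L2_set_def sum_nonneg)

lemma qnorm_cong: "(\<And>z. z \<in> bitstrings N \<Longrightarrow> v z = w z) \<Longrightarrow> qnorm N v = qnorm N w"
  by (simp add: qnorm_def cong: L2_set_cong)

lemma qnorm_add_le: "qnorm N (\<lambda>z. v z + w z) \<le> qnorm N v + qnorm N w"
proof -
  have "qnorm N (\<lambda>z. v z + w z) \<le> L2_set (\<lambda>z. cmod (v z) + cmod (w z)) (bitstrings N)"
    unfolding qnorm_def by (intro L2_set_mono norm_triangle_ineq) auto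
  also have "\<dots> \<le> qnorm N v + qnorm N w"
    unfolding qnorm_def by (rule L2_set_triangle_ineq)
  finally show ?thesis .
qed

lemma qnorm_minus_commute: "qnorm N (\<lambda>z. v z - w z) = qnorm N (\<lambda>z. w z - v z)"
  by (simp add: qnorm_def norm_minus_commute)

lemma qnorm_diff_le: "qnorm N (\<lambda>z. v z - w z) \<le> qnorm N v + qnorm N w"
  using qnorm_add_le[of N v "\<lambda>z. - w z"] by (simp add: qnorm_def)

lemma qnorm_triangle: "qnorm N (\<lambda>z. u z - w z) \<le> qnorm N (\<lambda>z. u z - v z) + qnorm N (\<lambda>z. v z - w z)"
  using qnorm_add_le[of N "\<lambda>z. u z - v z" "\<lambda>z. v z - w z"] by simp

lemma qnorm_scale: "qnorm N (\<lambda>z. c * v z) = cmod c * qnorm N v"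
  by (simp add: qnorm_def norm_mult L2_set_right_distrib)

lemma qnorm_sum_le:
  "finite S \<Longrightarrow> qnorm N (\<lambda>z. \<Sum>u\<in>S. v u z) \<le> (\<Sum>u\<in>S. qnorm N (v u))"
proof (induction S rule: finite_induct)
  case empty
  then show ?case by (simp add: qnorm_def L2_set_def)
next
  case (insert u S)
  then show ?case
    using qnorm_add_le[of N "v u" "\<lambda>z. \<Sum>u\<in>S. v u z"] by simp
qed

lemma qnorm_op_app:
  assumes "op_isometry N U"
  shows "qnorm N (op_app N U v) = qnorm N v"
proof -
  let ?B = "bitstrings N"
  have "complex_of_real ((qnorm N (op_app N U v))\<^sup>2)
      = (\<Sum>y\<in>?B. op_app N U v y * cnj (op_app N U v y))"
    by (simp add: qnorm_power2 complex_norm_square flip: of_real_power)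
  also have "\<dots> = (\<Sum>y\<in>?B. \<Sum>z\<in>?B. \<Sum>w\<in>?B. (U y z * v z) * cnj (U y w * v w))"
    by (simp add: op_app_def sum_product)
  also have "\<dots> = (\<Sum>z\<in>?B. \<Sum>y\<in>?B. \<Sum>w\<in>?B. (U y z * v z) * cnj (U y w * v w))"
    by (rule sum.swap)
  also have "\<dots> = (\<Sum>z\<in>?B. \<Sum>w\<in>?B. \<Sum>y\<in>?B. (U y z * v z) * cnj (U y w * v w))"
    by (intro sum.cong refl sum.swap)
  also have "\<dots> = (\<Sum>z\<in>?B. \<Sum>w\<in>?B. op_mult N (op_adj U) U w z * (v z * cnj (v w)))"
    by (simp add: op_mult_def op_adj_def sum_distrib_left mult_ac)
  also have "\<dots> = (\<Sum>z\<in>?B. \<Sum>w\<in>?B. op_id w z * (v z * cnj (v w)))"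
    using assms by (simp add: op_isometry_def op_eq_def)
  also have "\<dots> = (\<Sum>z\<in>?B. v z * cnj (v z))"
    by (simp add: op_id_def of_bool_def if_distrib if_distribR cong: if_cong)
  also have "\<dots> = complex_of_real ((qnorm N v)\<^sup>2)"
    by (simp add: qnorm_power2 complex_norm_square flip: of_real_power)
  finally have "(qnorm N (op_app N U v))\<^sup>2 = (qnorm N v)\<^sup>2"
    using of_real_eq_iff by blast
  then show ?thesis by simp
qed

lemma op_mult_tensor:
  assumes "x \<in> bitstrings (a + b)" "y \<in> bitstrings (a + b)"
  shows "op_mult (a + b) (op_tensor a U V) (op_tensor a U' V') x y
    = op_tensor a (op_mult a U U') (op_mult b V V') x y"
proof -
  have "op_mult (a + b) (op_tensor a U V) (op_tensor a U' V') x y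
     = (\<Sum>u\<in>bitstrings a. \<Sum>w\<in>bitstrings b. U (take a x) u * V (drop a x) w
          * (U' u (take a y) * V' w (drop a y)))"
    unfolding op_mult_def sum_bitstrings_add
    by (intro sum.cong refl) (simp add: op_tensor_def bitstrings_def)
  also have "\<dots> = op_tensor a (op_mult a U U') (op_mult b V V') x y"
    by (simp add: op_tensor_def op_mult_def sum_product mult_ac)
  finally show ?thesis .
qed

lemma op_adj_tensor: "op_adj (op_tensor a U V) = op_tensor a (op_adj U) (op_adj V)"
  by (simp add: op_adj_def op_tensor_def)


section \<open>Gates on arbitrary wire lists\<close>

lemma map_nth_in_bitstrings [simp]: "map ((!) x) ws \<in> bitstrings (length ws)"
  by (simp add: bitstrings_def)

text \<open>A string that agrees with \<open>y\<close> off the wires \<open>ws\<close> is determined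
  by its bits on \<open>ws\<close>, which are arbitrary. This turns the sum over
  \<open>N\<close>-bit strings in a product of gates into a sum over local strings.\<close>

lemma bij_betw_restrict_wires:
  assumes "distinct ws" "set ws \<subseteq> {..<N}" "y \<in> bitstrings N"
  shows "bij_betw (\<lambda>z. map ((!) z) ws)
    {z \<in> bitstrings N. \<forall>i<N. i \<notin> set ws \<longrightarrow> z ! i = y ! i} (bitstrings (length ws))"
proof (rule bij_betw_imageI)
  show "inj_on (\<lambda>z. map ((!) z) ws) {z \<in> bitstrings N. \<forall>i<N. i \<notin> set ws \<longrightarrow> z ! i = y ! i}"
  proof (rule inj_onI)
    fix z w
    assume z: "z \<in> {z \<in> bitstrings N. \<forall>i<N. i \<notin> set ws \<longrightarrow> z ! i = y ! i}"
      and w: "w \<in> {z \<in> bitstrings N. \<forall>i<N. i \<notin> set ws \<longrightarrow> z ! i = y ! i}"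
      and eq: "map ((!) z) ws = map ((!) w) ws"
    show "z = w"
    proof (rule nth_equalityI)
      show "length z = length w" using z w by (simp add: bitstrings_def)
      fix i assume "i < length z"
      then have "i < N" using z by (simp add: bitstrings_def)
      then show "z ! i = w ! i" using z w eq by (cases "i \<in> set ws") auto
    qed
  qed
  show "(\<lambda>z. map ((!) z) ws) ` {z \<in> bitstrings N. \<forall>i<N. i \<notin> set ws \<longrightarrow> z ! i = y ! i}
      = bitstrings (length ws)"
  proof (intro equalityI subsetI)
    fix u assume u: "u \<in> bitstrings (length ws)"
    \<comment> \<open>\<open>g\<close> sends a wire to its position in \<open>ws\<close>;
      \<open>z\<close> is \<open>y\<close> with \<open>u\<close> written onto the wires
      \<open>ws\<close>.\<close>
    define g where "g = the_inv_into {..<length ws} ((!) ws)"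
    define z where "z = map (\<lambda>i. if i \<in> set ws then u ! g i else y ! i) [0..<N]"
    have inj: "inj_on ((!) ws) {..<length ws}"
      using assms(1) by (simp add: inj_on_nth)
    have "map ((!) z) ws = u"
    proof (rule nth_equalityI)
      show "length (map ((!) z) ws) = length u" using u by (simp add: bitstrings_def)
      fix t assume "t < length (map ((!) z) ws)"
      then have t: "t < length ws" by simp
      then have "g (ws ! t) = t" unfolding g_def by (intro the_inv_into_f_f[OF inj]) simp
      moreover have "ws ! t < N" using t assms(2) nth_mem by blast
      ultimately show "map ((!) z) ws ! t = u ! t" using t by (simp add: z_def)
    qed
    moreover have "z \<in> {z \<in> bitstrings N. \<forall>i<N. i \<notin> set ws \<longrightarrow> z ! i = y ! i}"
      by (simp add: z_def bitstrings_def)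
    ultimately show "u \<in> (\<lambda>z. map ((!) z) ws) `
        {z \<in> bitstrings N. \<forall>i<N. i \<notin> set ws \<longrightarrow> z ! i = y ! i}"
      by (metis (no_types, lifting) image_eqI)
  qed auto
qed

text \<open>
  For a fixed wire list of any length, \<open>gate_op\<close> is a unital *-homomorphism, which is what allows
  circuits to be run on part of a larger register.
\<close>

lemma gate_op_mult:
  assumes ws: "distinct ws" "set ws \<subseteq> {..<N}" and y: "y \<in> bitstrings N"
  shows "op_mult N (gate_op N (ws, U)) (gate_op N (ws, V)) x y
    = gate_op N (ws, op_mult (length ws) U V) x y"
proof -
  let ?P = "\<lambda>x y. \<forall>i<N. i \<notin> set ws \<longrightarrow> x ! i = y ! i"
  let ?r = "\<lambda>z. map ((!) z) ws"
  have sum_if: "(\<Sum>u\<in>S. if b then h u else 0) = (if b then sum h S else 0)"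
    for S :: "bool list set" and b and h :: "bool list \<Rightarrow> complex" by simp
  \<comment> \<open>The second factor vanishes unless \<open>z\<close> agrees with \<open>y\<close>
    off \<open>ws\<close>; for such \<open>z\<close> the condition of the first factor is agreement
    of \<open>x\<close> with \<open>y\<close>, which no longer involves \<open>z\<close>.\<close>
  have "op_mult N (gate_op N (ws, U)) (gate_op N (ws, V)) x y
     = (\<Sum>z\<in>{z \<in> bitstrings N. ?P z y}. (if ?P x y then U (?r x) (?r z) * V (?r z) (?r y) else 0))"
    unfolding op_mult_def
    by (rule sum.mono_neutral_cong_right) (auto simp: gate_op_def)
  also have "\<dots> = (\<Sum>u\<in>bitstrings (length ws). (if ?P x y then U (?r x) u * V u (?r y) else 0))"
    by (rule sum.reindex_bij_betw[OF bij_betw_restrict_wires[OF ws y]])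
  also have "\<dots> = gate_op N (ws, op_mult (length ws) U V) x y"
    unfolding gate_op_def op_mult_def prod.case by (rule sum_if)
  finally show ?thesis .
qed

lemma op_adj_gate_op: "op_adj (gate_op N (ws, U)) = gate_op N (ws, op_adj U)"
  by (auto simp: op_adj_def gate_op_def fun_eq_iff)

lemma gate_op_id:
  assumes "set ws \<subseteq> {..<N}" "x \<in> bitstrings N" "y \<in> bitstrings N"
  shows "gate_op N (ws, op_id) x y = op_id x y"
proof -
  have "x = y" if "\<forall>i<N. i \<notin> set ws \<longrightarrow> x ! i = y ! i" "map ((!) x) ws = map ((!) y) ws"
  proof (rule nth_equalityI)
    show "length x = length y" using assms by (simp add: bitstrings_def)
    fix i assume "i < length x"
    then have "i < N" using assms by (simp add: bitstrings_def)
    then show "x ! i = y ! i" using that by (cases "i \<in> set ws") auto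
  qed
  then show ?thesis by (auto simp: gate_op_def op_id_def)
qed

lemma gate_op_cong:
  assumes "op_eq (length ws) U V"
  shows "gate_op N (ws, U) = gate_op N (ws, V)"
  using assms by (auto simp: gate_op_def op_eq_def fun_eq_iff)

lemma op_isometry_gate_op:
  assumes "distinct ws" "set ws \<subseteq> {..<N}" "op_isometry (length ws) U"
  shows "op_isometry N (gate_op N (ws, U))"
  unfolding op_isometry_def
proof (rule op_eqI)
  fix x y assume xy: "x \<in> bitstrings N" "y \<in> bitstrings N"
  have "op_mult N (op_adj (gate_op N (ws, U))) (gate_op N (ws, U)) x y
      = gate_op N (ws, op_mult (length ws) (op_adj U) U) x y"
    using assms xy by (simp add: op_adj_gate_op gate_op_mult)
  also have "\<dots> = gate_op N (ws, op_id) x y"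
    using gate_op_cong[OF assms(3)[unfolded op_isometry_def]] by metis
  also have "\<dots> = op_id x y" using assms xy by (simp add: gate_op_id)
  finally show "op_mult N (op_adj (gate_op N (ws, U))) (gate_op N (ws, U)) x y = op_id x y" .
qed

text \<open>Agreement off the inner wires amounts to agreement off \<open>ws\<close> together with
  agreement on the entries of \<open>ws\<close> that the gate leaves alone. A gate of a transplanted
  circuit is thus nested in the wire list of the whole circuit.\<close>

lemma gate_op_gate_op:
  assumes "set vs \<subseteq> {..<length ws}" "set ws \<subseteq> {..<N}" "distinct ws"
  shows "gate_op N (map ((!) ws) vs, U) x y = gate_op N (ws, gate_op (length ws) (vs, U)) x y"
proof -
  have "(\<forall>i<N. i \<notin> set (map ((!) ws) vs) \<longrightarrow> x ! i = y ! i) \<longleftrightarrow>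
      (\<forall>i<N. i \<notin> set ws \<longrightarrow> x ! i = y ! i) \<and>
      (\<forall>t<length ws. t \<notin> set vs \<longrightarrow> map ((!) x) ws ! t = map ((!) y) ws ! t)"
    (is "?L \<longleftrightarrow> ?R1 \<and> ?R2")
  proof (intro iffI conjI)
    assume ?L
    then show ?R1 using assms(1) by fastforce
    show ?R2
    proof (intro allI impI)
      fix t assume t: "t < length ws" "t \<notin> set vs"
      then have "ws ! t \<notin> set (map ((!) ws) vs)"
        using assms by (auto simp: nth_eq_iff_index_eq subset_iff)
      moreover have "ws ! t < N" using t assms(2) nth_mem by blast
      ultimately show "map ((!) x) ws ! t = map ((!) y) ws ! t" using \<open>?L\<close> t(1) by simp
    qed
  next
    assume R: "?R1 \<and> ?R2"
    show ?L
    proof (intro allI impI)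
      fix i assume i: "i < N" "i \<notin> set (map ((!) ws) vs)"
      show "x ! i = y ! i"
      proof (cases "i \<in> set ws")
        case True
        then obtain t where "t < length ws" "i = ws ! t" by (metis in_set_conv_nth)
        then show ?thesis using R i by auto
      qed (use R i in auto)
    qed
  qed
  moreover have "map ((!) (map ((!) z) ws)) vs = map ((!) z) (map ((!) ws) vs)" for z :: "bool list"
    using assms(1) by auto
  moreover have "(if a \<and> b then c else 0) = (if a then if b then c else 0 else 0)"
    for a b and c :: complex by simp
  ultimately show ?thesis unfolding gate_op_def prod.case by (simp only:)
qed

text \<open>This is \<open>U \<otimes> I\<close>: agreement off the first \<open>N\<close> wires is
  equality of the remaining parts.\<close>

lemma gate_op_upt:
  assumes "x \<in> bitstrings (N + d)" "y \<in> bitstrings (N + d)"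
  shows "gate_op (N + d) ([0..<N], U) x y
    = U (take N x) (take N y) * of_bool (drop N x = drop N y)"
proof -
  have tk: "map ((!) z) [0..<N] = take N z" if "z \<in> bitstrings (N + d)" for z
    using that by (intro nth_equalityI) (auto simp: bitstrings_def)
  have "(\<forall>i<N + d. i \<notin> set [0..<N] \<longrightarrow> x ! i = y ! i) \<longleftrightarrow> drop N x = drop N y"
  proof
    assume "\<forall>i<N + d. i \<notin> set [0..<N] \<longrightarrow> x ! i = y ! i"
    then show "drop N x = drop N y"
      using assms by (intro nth_equalityI) (auto simp: bitstrings_def)
  next
    assume eq: "drop N x = drop N y"
    show "\<forall>i<N + d. i \<notin> set [0..<N] \<longrightarrow> x ! i = y ! i"
    proof (intro allI impI)
      fix i assume "i < N + d" "i \<notin> set [0..<N]"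
      then have "drop N x ! (i - N) = x ! i" "drop N y ! (i - N) = y ! i"
        using assms by (auto simp: bitstrings_def)
      then show "x ! i = y ! i" using eq by simp
    qed
  qed
  then show ?thesis using assms by (simp add: gate_op_def tk)
qed


section \<open>Circuits\<close>

lemma valid_circuit_append [simp]:
  "valid_circuit N (C @ D) \<longleftrightarrow> valid_circuit N C \<and> valid_circuit N D"
  by (auto simp: valid_circuit_def)

lemma valid_circuit_Cons [simp]:
  "valid_circuit N (g # C) \<longleftrightarrow> valid_gate N g \<and> valid_circuit N C"
  by (auto simp: valid_circuit_def)

lemma valid_circuit_Nil [simp]: "valid_circuit N []"
  by (simp add: valid_circuit_def)

lemma circuit_op_append:
  assumes "y \<in> bitstrings N"
  shows "circuit_op N (C @ D) x y = op_mult N (circuit_op N D) (circuit_op N C) x y"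
  using assms
proof (induction C arbitrary: x y)
  case Nil
  then show ?case by (simp add: op_mult_id_right)
next
  case (Cons g C)
  have "circuit_op N ((g # C) @ D) x y
      = op_mult N (op_mult N (circuit_op N D) (circuit_op N C)) (gate_op N g) x y"
    using Cons.IH by (auto intro!: op_mult_cong)
  then show ?case by (simp add: op_mult_assoc)
qed

lemma op_isometry_circuit_op:
  "valid_circuit N C \<Longrightarrow> op_isometry N (circuit_op N C)"
proof (induction C)
  case Nil
  then show ?case by (simp add: op_isometry_id)
next
  case (Cons g C)
  obtain ws U where g: "g = (ws, U)" by (cases g)
  have "op_isometry N (gate_op N g)"
    using Cons.prems by (auto simp: g valid_gate_def op_unitary_def op_isometry_def[symmetric]
        intro!: op_isometry_gate_op)
  then show ?case using Cons by (simp add: op_isometry_mult)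
qed

section \<open>Placing a circuit on chosen wires of a larger register\<close>

definition relabel :: "nat list \<Rightarrow> gate list \<Rightarrow> gate list" where
  "relabel ws = map (\<lambda>(vs, U). (map ((!) ws) vs, U))"

lemma length_relabel [simp]: "length (relabel ws C) = length C"
  by (simp add: relabel_def)

lemma valid_circuit_relabel:
  assumes "distinct ws" "set ws \<subseteq> {..<N}" "valid_circuit (length ws) C"
  shows "valid_circuit N (relabel ws C)"
proof -
  have "valid_gate N (map ((!) ws) vs, U)" if "valid_gate (length ws) (vs, U)" for vs U
  proof -
    have *: "set vs \<subseteq> {..<length ws}" "distinct vs" using that by (auto simp: valid_gate_def)
    have "inj_on ((!) ws) (set vs)"
      using assms(1) * by (intro inj_on_nth) auto
    moreover have "ws ! i < N" if "i \<in> set vs" for i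
      using that * assms(2) by (metis lessThan_iff nth_mem subset_iff)
    ultimately show ?thesis using that by (auto simp: valid_gate_def distinct_map)
  qed
  then show ?thesis using assms(3) by (auto simp: valid_circuit_def relabel_def)
qed

text \<open>Induction over the gates: \<open>gate_op\<close> on the fixed wire list
  \<open>ws\<close> is multiplicative, so the nested gates multiply up to the operator of the
  circuit, treated as one large gate.\<close>

lemma circuit_op_relabel:
  assumes "distinct ws" "set ws \<subseteq> {..<N}" "valid_circuit (length ws) C"
    "x \<in> bitstrings N" "y \<in> bitstrings N"
  shows "circuit_op N (relabel ws C) x y = gate_op N (ws, circuit_op (length ws) C) x y"
  using assms(3-5)
proof (induction C arbitrary: x y)
  case Nil
  then show ?case using assms(2) by (simp add: relabel_def gate_op_id)
next
  case (Cons g C)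
  obtain vs U where g: "g = (vs, U)" by (cases g)
  have vs: "set vs \<subseteq> {..<length ws}" using Cons.prems by (simp add: g valid_gate_def)
  have "circuit_op N (relabel ws (g # C)) x y
      = op_mult N (circuit_op N (relabel ws C)) (gate_op N (map ((!) ws) vs, U)) x y"
    by (simp add: g relabel_def)
  also have "\<dots> = op_mult N (gate_op N (ws, circuit_op (length ws) C))
      (gate_op N (ws, gate_op (length ws) (vs, U))) x y"
    using Cons assms vs by (intro op_mult_cong) (auto simp: gate_op_gate_op)
  also have "\<dots> = gate_op N (ws, circuit_op (length ws) (g # C)) x y"
    using assms Cons.prems by (simp add: gate_op_mult g)
  finally show ?case .
qed

text \<open>Adding idle wires at the end is the relabelling by \<open>[0..<N]\<close>, which leaves
  the gate list unchanged; the next two facts rest on this.\<close>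

lemma relabel_upt:
  assumes "valid_circuit N C"
  shows "relabel [0..<N] C = C"
proof -
  have "map ((!) [0..<N]) vs = vs" if "valid_gate N (vs, U)" for vs U
    using that by (intro map_idI) (auto simp: valid_gate_def)
  then show ?thesis
    using assms unfolding relabel_def valid_circuit_def by (intro map_idI) auto
qed

lemma valid_circuit_mono:
  assumes "valid_circuit N C"
  shows "valid_circuit (N + d) C"
  using valid_circuit_relabel[of "[0..<N]" "N + d" C] assms relabel_upt[OF assms]
  by (simp add: lessThan_atLeast0)

lemma circuit_op_extra_wires:
  assumes "valid_circuit N C" "x \<in> bitstrings (N + d)" "y \<in> bitstrings (N + d)"
  shows "circuit_op (N + d) C x y
    = circuit_op N C (take N x) (take N y) * of_bool (drop N x = drop N y)"
proof -
  have "circuit_op (N + d) C x y = gate_op (N + d) ([0..<N], circuit_op N C) x y"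
    using circuit_op_relabel[of "[0..<N]" "N + d" C x y] assms relabel_upt[OF assms(1)]
    by (simp add: lessThan_atLeast0)
  then show ?thesis using assms by (simp add: gate_op_upt)
qed

definition inverse_circuit :: "gate list \<Rightarrow> gate list" where
  "inverse_circuit C = rev (map (\<lambda>(ws, U). (ws, op_adj U)) C)"

lemma length_inverse_circuit [simp]: "length (inverse_circuit C) = length C"
  by (simp add: inverse_circuit_def)

lemma valid_inverse_circuit:
  "valid_circuit N C \<Longrightarrow> valid_circuit N (inverse_circuit C)"
  by (auto simp: valid_circuit_def inverse_circuit_def valid_gate_def op_unitary_def)

lemma circuit_op_inverse_circuit:
  "x \<in> bitstrings N \<Longrightarrow> y \<in> bitstrings N \<Longrightarrow>
    circuit_op N (inverse_circuit C) x y = op_adj (circuit_op N C) x y"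
proof (induction C arbitrary: x y)
  case Nil
  then show ?case by (auto simp: inverse_circuit_def op_adj_def op_id_def)
next
  case (Cons g C)
  obtain ws U where g: "g = (ws, U)" by (cases g)
  have "circuit_op N (inverse_circuit (g # C)) x y
      = op_mult N (op_mult N op_id (gate_op N (ws, op_adj U))) (circuit_op N (inverse_circuit C)) x y"
    using Cons.prems by (simp add: inverse_circuit_def g circuit_op_append)
  also have "\<dots> = op_mult N (op_adj (gate_op N g)) (op_adj (circuit_op N C)) x y"
    using Cons by (intro op_mult_cong) (auto simp: op_mult_id_left g op_adj_gate_op)
  also have "\<dots> = op_adj (circuit_op N (g # C)) x y" by (simp add: op_adj_mult)
  finally show ?case .
qed

text \<open>CNOT, swap and phase gates map a basis state to a multiple of a basis state, so circuits
  made of them are traced one basis state at a time. The CNOT and swap lemmas below carry a factor 1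
  to fit this form.\<close>

lemma circuit_op_Cons_monomial:
  assumes "\<And>z. z \<in> bitstrings N \<Longrightarrow> gate_op N g z x = c * of_bool (z = x')"
    and "x' \<in> bitstrings N"
  shows "circuit_op N (g # C) y x = c * circuit_op N C y x'"
proof -
  have "circuit_op N (g # C) y x
      = (\<Sum>z\<in>bitstrings N. circuit_op N C y z * (c * of_bool (z = x')))"
    using assms(1) by (simp add: op_mult_def)
  also have "\<dots> = c * circuit_op N C y x'"
    using assms(2) by (simp add: of_bool_def if_distrib if_distribR cong: if_cong)
  finally show ?thesis .
qed

section \<open>Circuits with work qubits\<close>

lemma implementsI:
  assumes "valid_circuit (k + m) C"
    and "\<And>x u w. x \<in> bitstrings k \<Longrightarrow> u \<in> bitstrings k \<Longrightarrow> w \<in> bitstrings m \<Longrightarrow>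
        circuit_op (k + m) C (u @ w) (x @ zeros m) = U u x * of_bool (w = zeros m)"
  shows "implements k C U"
  unfolding implements_def
proof (intro exI[of _ m] conjI assms(1) ballI)
  fix x y assume x: "x \<in> bitstrings k" and y: "y \<in> bitstrings (k + m)"
  obtain u w where "y = u @ w" "u \<in> bitstrings k" "w \<in> bitstrings m"
    using y by (rule bitstrings_addE)
  then show "circuit_op (k + m) C y (x @ zeros m) = U (take k y) x * ket (zeros m) (drop k y)"
    using assms(2)[OF x] by (auto simp: ket_def bitstrings_def)
qed

text \<open>Additional work qubits stay idle at zero, so any number \<open>M \<ge> m\<close> of them
  serves as well. Circuits with different demands can then share one register.\<close>

lemma implementsE:
  assumes "implements k C U"
  obtains m where "\<And>M. M \<ge> m \<Longrightarrow> valid_circuit (k + M) C"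
    and "\<And>M x u w. M \<ge> m \<Longrightarrow> x \<in> bitstrings k \<Longrightarrow> u \<in> bitstrings k \<Longrightarrow> w \<in> bitstrings M \<Longrightarrow>
        circuit_op (k + M) C (u @ w) (x @ zeros M) = U u x * of_bool (w = zeros M)"
proof -
  obtain m where v: "valid_circuit (k + m) C"
    and c: "\<And>x y. x \<in> bitstrings k \<Longrightarrow> y \<in> bitstrings (k + m) \<Longrightarrow>
        circuit_op (k + m) C y (x @ zeros m) = U (take k y) x * ket (zeros m) (drop k y)"
    using assms unfolding implements_def by blast
  show ?thesis
  proof (rule that[of m])
    fix M assume "m \<le> M"
    then obtain d where M: "M = m + d" using le_Suc_ex by blast
    show "valid_circuit (k + M) C" using valid_circuit_mono[OF v, of d] by (simp add: M add.assoc)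
    fix x u w
    assume x: "x \<in> bitstrings k" and u: "u \<in> bitstrings k" and w: "w \<in> bitstrings M"
    obtain w1 w2 where w12: "w = w1 @ w2" "w1 \<in> bitstrings m" "w2 \<in> bitstrings d"
      using w unfolding M by (rule bitstrings_addE)
    have z: "zeros M = zeros m @ zeros d" by (simp add: M replicate_add)
    have "circuit_op (k + M) C (u @ w) (x @ zeros M)
        = circuit_op (k + m) C (u @ w1) (x @ zeros m) * of_bool (w2 = zeros d)"
      using circuit_op_extra_wires[OF v, of "u @ w" d "x @ zeros M"] x u w12
      by (simp add: bitstrings_def M z add.assoc del: replicate_add flip: replicate_add)
    also have "\<dots> = U u x * of_bool (w = zeros M)"
      using c[OF x, of "u @ w1"] u w12 by (auto simp: ket_def z bitstrings_def)
    finally show "circuit_op (k + M) C (u @ w) (x @ zeros M) = U u x * of_bool (w = zeros M)" .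
  qed
qed

lemma implements_circuit:
  assumes "valid_circuit k C"
  shows "implements k C (circuit_op k C)"
  by (rule implementsI[of k 0]) (use assms in \<open>auto simp: bitstrings_def\<close>)

text \<open>The first circuit returns its work qubits to zero, so the second can reuse them.\<close>

lemma implements_append:
  assumes "implements k C U" "implements k D V"
  shows "implements k (C @ D) (op_mult k V U)"
proof -
  obtain m1 where v1: "\<And>M. M \<ge> m1 \<Longrightarrow> valid_circuit (k + M) C"
    and c1: "\<And>M x u w. M \<ge> m1 \<Longrightarrow> x \<in> bitstrings k \<Longrightarrow> u \<in> bitstrings k \<Longrightarrow> w \<in> bitstrings M \<Longrightarrow>
        circuit_op (k + M) C (u @ w) (x @ zeros M) = U u x * of_bool (w = zeros M)"
    by (rule implementsE[OF assms(1)]) blast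
  obtain m2 where v2: "\<And>M. M \<ge> m2 \<Longrightarrow> valid_circuit (k + M) D"
    and c2: "\<And>M x u w. M \<ge> m2 \<Longrightarrow> x \<in> bitstrings k \<Longrightarrow> u \<in> bitstrings k \<Longrightarrow> w \<in> bitstrings M \<Longrightarrow>
        circuit_op (k + M) D (u @ w) (x @ zeros M) = V u x * of_bool (w = zeros M)"
    by (rule implementsE[OF assms(2)]) blast
  define M where "M = max m1 m2"
  have M: "m1 \<le> M" "m2 \<le> M" by (auto simp: M_def)
  show ?thesis
  proof (rule implementsI[of k M])
    show "valid_circuit (k + M) (C @ D)" using v1 v2 M by simp
    fix x u w
    assume x: "x \<in> bitstrings k" and u: "u \<in> bitstrings k" and w: "w \<in> bitstrings M"
    have "circuit_op (k + M) (C @ D) (u @ w) (x @ zeros M)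
      = (\<Sum>a\<in>bitstrings k. \<Sum>b\<in>bitstrings M. circuit_op (k + M) D (u @ w) (a @ b)
          * (U a x * of_bool (b = zeros M)))"
      using x M c1 by (simp add: circuit_op_append op_mult_def sum_bitstrings_add)
    also have "\<dots> = (\<Sum>a\<in>bitstrings k. circuit_op (k + M) D (u @ w) (a @ zeros M) * U a x)"
      by (simp add: of_bool_def if_distrib if_distribR cong: if_cong)
    also have "\<dots> = (\<Sum>a\<in>bitstrings k. V u a * U a x * of_bool (w = zeros M))"
      using c2[OF M(2) _ u w] by (intro sum.cong refl) simp
    also have "\<dots> = op_mult k V U u x * of_bool (w = zeros M)"
      by (simp only: op_mult_def sum_distrib_right)
    finally show "circuit_op (k + M) (C @ D) (u @ w) (x @ zeros M)
        = op_mult k V U u x * of_bool (w = zeros M)" .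
  qed
qed

text \<open>On inputs with zero work qubits all output amplitudes lie on zero work qubits, so the
  inner products of columns of \<open>U\<close> are those of columns of the circuit. For the
  conjugated reflections this yields the isometry property directly from easiness.\<close>

lemma implements_isometry:
  assumes "implements k C U"
  shows "op_isometry k U"
  unfolding op_isometry_def
proof (rule op_eqI)
  fix x y assume x: "x \<in> bitstrings k" and y: "y \<in> bitstrings k"
  obtain m where v: "valid_circuit (k + m) C"
    and c: "\<And>x u w. x \<in> bitstrings k \<Longrightarrow> u \<in> bitstrings k \<Longrightarrow> w \<in> bitstrings m \<Longrightarrow>
        circuit_op (k + m) C (u @ w) (x @ zeros m) = U u x * of_bool (w = zeros m)"
    by (rule implementsE[OF assms]) blast
  have "op_id x y = (op_id (x @ zeros m) (y @ zeros m) :: complex)" by (simp add: op_id_def)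
  also have "\<dots> = op_mult (k + m) (op_adj (circuit_op (k + m) C)) (circuit_op (k + m) C)
      (x @ zeros m) (y @ zeros m)"
    using op_isometry_circuit_op[OF v] x y by (simp add: op_isometry_def op_eq_def)
  also have "\<dots> = (\<Sum>u\<in>bitstrings k. \<Sum>w\<in>bitstrings m.
      cnj (U u x * of_bool (w = zeros m)) * (U u y * of_bool (w = zeros m)))"
    using c x y by (simp add: op_mult_def op_adj_def sum_bitstrings_add)
  also have "\<dots> = op_mult k (op_adj U) U x y"
    by (simp add: op_mult_def op_adj_def of_bool_def if_distrib if_distribR cong: if_cong)
  finally show "op_mult k (op_adj U) U x y = op_id x y" by simp
qed


section \<open>Elementary circuits\<close>

definition cnot :: qop where
  "cnot = (\<lambda>x y. of_bool (x = [y ! 0, y ! 0 \<noteq> y ! 1]))"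

definition swap_gate :: qop where
  "swap_gate = (\<lambda>x y. of_bool (x = [y ! 1, y ! 0]))"

definition phase_00 :: qop where
  "phase_00 = (\<lambda>x y. (if x = [False, False] then - 1 else 1) * of_bool (x = y))"

definition hadamard :: qop where
  "hadamard = (\<lambda>x y. (if x = [True] \<and> y = [True] then - 1 else 1) / complex_of_real (sqrt 2))"

lemma bitstrings_Suc: "bitstrings (Suc n) = Cons False ` bitstrings n \<union> Cons True ` bitstrings n"
proof (intro equalityI subsetI)
  fix x assume "x \<in> bitstrings (Suc n)"
  then obtain b u where "x = b # u" "u \<in> bitstrings n"
    by (auto simp: bitstrings_def length_Suc_conv)
  then show "x \<in> Cons False ` bitstrings n \<union> Cons True ` bitstrings n" by (cases b) auto
qed (auto simp: bitstrings_def)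

lemma bitstrings_0: "bitstrings 0 = {[]}"
  by (simp add: bitstrings_def)

lemmas bitstrings_explicit = bitstrings_Suc bitstrings_0

lemma op_unitary_cnot: "op_unitary (Suc (Suc 0)) cnot"
  by (simp add: op_unitary_def op_eq_def op_mult_def op_adj_def op_id_def bitstrings_explicit cnot_def)

lemma op_unitary_swap_gate: "op_unitary (Suc (Suc 0)) swap_gate"
  by (simp add: op_unitary_def op_eq_def op_mult_def op_adj_def op_id_def bitstrings_explicit swap_gate_def)

lemma op_unitary_phase_00: "op_unitary (Suc (Suc 0)) phase_00"
  by (simp add: op_unitary_def op_eq_def op_mult_def op_adj_def op_id_def bitstrings_explicit phase_00_def)

lemma op_unitary_hadamard: "op_unitary (Suc 0) hadamard"
  by (simp add: op_unitary_def op_eq_def op_mult_def op_adj_def op_id_def bitstrings_explicit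
      hadamard_def flip: of_real_mult)

lemma eq_list_update2_iff:
  assumes "x \<in> bitstrings N" "y \<in> bitstrings N" "i < N" "j < N" "i \<noteq> j"
  shows "(\<forall>k<N. k \<notin> set [i, j] \<longrightarrow> x ! k = y ! k) \<and> x ! i = b \<and> x ! j = c
    \<longleftrightarrow> x = y[i := b, j := c]" (is "?L \<longleftrightarrow> _")
proof
  assume L: ?L
  show "x = y[i := b, j := c]"
  proof (rule nth_equalityI)
    show "length x = length (y[i := b, j := c])" using assms by (simp add: bitstrings_def)
    fix k assume "k < length x"
    then have "k < N" "k < length y" using assms by (auto simp: bitstrings_def)
    then show "x ! k = y[i := b, j := c] ! k"
      using L assms(5) by (cases "k = i"; cases "k = j") (auto simp: nth_list_update)
  qed
next
  assume "x = y[i := b, j := c]"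
  then show ?L using assms by (auto simp: bitstrings_def nth_list_update)
qed

lemma if_of_bool_eqI: "(a \<and> b \<longleftrightarrow> c) \<Longrightarrow> (if a then of_bool b else 0) = (1 * of_bool c :: complex)"
  by auto

lemma gate_op_cnot:
  assumes "x \<in> bitstrings N" "y \<in> bitstrings N" "i < N" "j < N" "i \<noteq> j"
  shows "gate_op N ([i, j], cnot) x y = 1 * of_bool (x = y[j := (y ! i \<noteq> y ! j)])"
  unfolding gate_op_def cnot_def prod.case
  using eq_list_update2_iff[OF assms, of "y ! i" "y ! i \<noteq> y ! j"]
  by (intro if_of_bool_eqI) simp

lemma gate_op_swap_gate:
  assumes "x \<in> bitstrings N" "y \<in> bitstrings N" "i < N" "j < N" "i \<noteq> j"
  shows "gate_op N ([i, j], swap_gate) x y = 1 * of_bool (x = y[i := y ! j, j := y ! i])"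
  unfolding gate_op_def swap_gate_def prod.case
  using eq_list_update2_iff[OF assms, of "y ! j" "y ! i"]
  by (intro if_of_bool_eqI) simp

lemma gate_op_phase_00:
  assumes "x \<in> bitstrings N" "y \<in> bitstrings N" "i < N" "j < N" "i \<noteq> j"
  shows "gate_op N ([i, j], phase_00) x y
    = (if \<not> y ! i \<and> \<not> y ! j then - 1 else 1) * of_bool (x = y)"
proof -
  have "(\<forall>k<N. k \<notin> set [i, j] \<longrightarrow> x ! k = y ! k) \<and> map ((!) x) [i, j] = map ((!) y) [i, j]
      \<longleftrightarrow> x = y"
    using eq_list_update2_iff[OF assms, of "y ! i" "y ! j"] by simp
  then show ?thesis by (auto simp: gate_op_def phase_00_def)
qed

text \<open>Two CNOTs turn the comparison of two pairs of bits into a test for \<open>00\<close>.\<close>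

definition compare_circuit :: "nat \<Rightarrow> nat \<Rightarrow> nat \<Rightarrow> nat \<Rightarrow> gate list" where
  "compare_circuit a b c d = [([a, c], cnot), ([b, d], cnot), ([c, d], phase_00),
     ([b, d], cnot), ([a, c], cnot)]"

lemma valid_compare_circuit:
  "\<lbrakk>a < N; b < N; c < N; d < N; distinct [a, b, c, d]\<rbrakk> \<Longrightarrow> valid_circuit N (compare_circuit a b c d)"
  by (simp add: compare_circuit_def valid_gate_def op_unitary_cnot op_unitary_phase_00)

lemma list_update_in_bitstrings [simp]: "x[i := b] \<in> bitstrings N \<longleftrightarrow> x \<in> bitstrings N"
  by (simp add: bitstrings_def)

lemma circuit_op_compare_circuit:
  assumes x: "x \<in> bitstrings N" and "a < N" "b < N" "c < N" "d < N" "distinct [a, b, c, d]"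
  shows "circuit_op N (compare_circuit a b c d) y x
    = (if x ! a = x ! c \<and> x ! b = x ! d then - 1 else 1) * of_bool (y = x)"
proof -
  define x1 where "x1 = x[c := (x ! a \<noteq> x ! c)]"
  define x2 where "x2 = x1[d := (x1 ! b \<noteq> x1 ! d)]"
  have len: "length x = N" using x by (simp add: bitstrings_def)
  have x1: "x1 \<in> bitstrings N" and x2: "x2 \<in> bitstrings N" using x by (simp_all add: x1_def x2_def)
  \<comment> \<open>CNOT is its own inverse: the last two gates restore \<open>x1\<close> and then
    \<open>x\<close>.\<close>
  have e1: "x2[d := (x2 ! b \<noteq> x2 ! d)] = x1" and e2: "x1[c := (x1 ! a \<noteq> x1 ! c)] = x"
    using assms(2-) len by (auto simp: x2_def x1_def list_eq_iff_nth_eq nth_list_update)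
  have "circuit_op N (compare_circuit a b c d) y x
      = 1 * (1 * ((if \<not> x2 ! c \<and> \<not> x2 ! d then - 1 else 1) * (1 * (1 * circuit_op N [] y x))))"
    unfolding compare_circuit_def
    apply (subst circuit_op_Cons_monomial[where c = 1 and x' = x1])
    subgoal using gate_op_cnot[of _ N x a c] assms by (simp add: x1_def)
    subgoal by (rule x1)
    apply (subst circuit_op_Cons_monomial[where c = 1 and x' = x2])
    subgoal using gate_op_cnot[of _ N x1 b d] assms x1 by (simp add: x2_def)
    subgoal by (rule x2)
    apply (subst circuit_op_Cons_monomial[OF gate_op_phase_00 x2])
    subgoal by assumption
    subgoal by (rule x2)
    subgoal using assms by simp
    subgoal using assms by simp
    subgoal using assms by simp
    apply (subst circuit_op_Cons_monomial[where c = 1 and x' = x1])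
    subgoal using gate_op_cnot[of _ N x2 b d] assms x2 e1 by simp
    subgoal by (rule x1)
    apply (subst circuit_op_Cons_monomial[where c = 1 and x' = x])
    subgoal using gate_op_cnot[of _ N x1 a c] assms x1 e2 by simp
    subgoal by (rule x)
    by (rule refl)
  moreover have "x2 ! c = (x ! a \<noteq> x ! c)" "x2 ! d = (x ! b \<noteq> x ! d)"
    using assms(2-) len by (auto simp: x2_def x1_def nth_list_update)
  ultimately show ?thesis by (auto simp: op_id_def)
qed

text \<open>The preimage is produced in the second register while the output is measured on the
  first; these swaps exchange the two at the end.\<close>

definition swap_circuit :: "nat \<Rightarrow> gate list" where
  "swap_circuit n = map (\<lambda>i. ([i, n + i], swap_gate)) [0..<n]"

lemma circuit_op_swap_circuit:
  assumes "a \<in> bitstrings n" "b \<in> bitstrings n" "c \<in> bitstrings m"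
    and y: "y \<in> bitstrings (n + n + m)"
  shows "valid_circuit (n + n + m) (swap_circuit n)"
    and "circuit_op (n + n + m) (swap_circuit n) y (a @ b @ c) = of_bool (y = b @ a @ c)"
proof -
  let ?N = "n + n + m"
  show "valid_circuit ?N (swap_circuit n)"
    by (auto simp: valid_circuit_def swap_circuit_def valid_gate_def op_unitary_swap_gate)
  \<comment> \<open>\<open>st k\<close> is the basis state after the first \<open>k\<close> pairs of
    wires have been swapped.\<close>
  define st where "st k = (take k b @ drop k a) @ (take k a @ drop k b) @ c" for k
  have len: "length a = n" "length b = n" "length c = m" using assms by (simp_all add: bitstrings_def)
  have st: "st k \<in> bitstrings ?N" for k
    using len by (simp add: st_def bitstrings_def)
  have st_Suc: "(st k)[k := st k ! (n + k), n + k := st k ! k] = st (Suc k)" if k: "k < n" for k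
  proof -
    define P Q R where "P = take k b" and "Q = drop (Suc k) a @ take k a" and "R = drop (Suc k) b @ c"
    have "st k = P @ a ! k # Q @ b ! k # R"
      using k len by (simp add: st_def Cons_nth_drop_Suc P_def Q_def R_def)
    moreover have "st (Suc k) = P @ b ! k # Q @ a ! k # R"
      using k len by (simp add: st_def take_Suc_conv_app_nth P_def Q_def R_def)
    moreover have "k = length P" "n + k = Suc (length P + length Q)"
      using k len by (simp_all add: P_def Q_def)
    moreover have "(P @ p # Q @ q # R)[length P := (P @ p # Q @ q # R) ! Suc (length P + length Q),
        Suc (length P + length Q) := (P @ p # Q @ q # R) ! length P] = P @ q # Q @ p # R" for p q
      by (simp add: nth_append list_update_append)
    ultimately show ?thesis by metis
  qed
  have "circuit_op ?N (map (\<lambda>i. ([i, n + i], swap_gate)) [k..<n]) y (st k) = of_bool (y = st n)"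
    if "k \<le> n" for k
    using that
  proof (induction k rule: inc_induct)
    case base
    then show ?case by (simp add: op_id_def)
  next
    case (step k)
    have "circuit_op ?N (([k, n + k], swap_gate) # map (\<lambda>i. ([i, n + i], swap_gate)) [Suc k..<n]) y (st k)
        = 1 * circuit_op ?N (map (\<lambda>i. ([i, n + i], swap_gate)) [Suc k..<n]) y (st (Suc k))"
    proof (rule circuit_op_Cons_monomial)
      fix z assume "z \<in> bitstrings ?N"
      then show "gate_op ?N ([k, n + k], swap_gate) z (st k) = 1 * of_bool (z = st (Suc k))"
        using step.hyps st by (subst gate_op_swap_gate) (auto simp: st_Suc)
    qed (rule st)
    then show ?case using step by (simp add: upt_conv_Cons)
  qed
  from this[of 0] show "circuit_op ?N (swap_circuit n) y (a @ b @ c) = of_bool (y = b @ a @ c)"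
    using len by (simp add: swap_circuit_def st_def)
qed

definition hadamard_circuit :: "nat \<Rightarrow> nat \<Rightarrow> gate list" where
  "hadamard_circuit n k = map (\<lambda>i. ([i], hadamard)) [n..<n + k]"

lemma valid_hadamard_circuit: "n + k \<le> N \<Longrightarrow> valid_circuit N (hadamard_circuit n k)"
  by (auto simp: valid_circuit_def hadamard_circuit_def valid_gate_def op_unitary_hadamard)

text \<open>Each Hadamard gate meets a wire that still holds 0, so its negative entry never enters
  and all amplitudes are equal.\<close>

lemma circuit_op_hadamard_circuit:
  assumes x: "x \<in> bitstrings N" and zero: "\<And>i. n \<le> i \<Longrightarrow> i < n + k \<Longrightarrow> \<not> x ! i"
  shows "n + k \<le> N \<Longrightarrow> y \<in> bitstrings N \<Longrightarrow> circuit_op N (hadamard_circuit n k) y x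
    = of_bool (\<forall>i<N. i \<notin> {n..<n + k} \<longrightarrow> y ! i = x ! i) / complex_of_real (sqrt 2) ^ k"
  using zero
proof (induction k arbitrary: y)
  case 0
  then show ?case
    using x by (auto simp: hadamard_circuit_def op_id_def list_eq_iff_nth_eq bitstrings_def)
next
  case (Suc k)
  let ?i = "n + k"
  let ?P = "\<lambda>k y. \<forall>i<N. i \<notin> {n..<n + k} \<longrightarrow> y ! i = x ! i"
  \<comment> \<open>Before the last gate, wire \<open>n + k\<close> still holds 0, so
    \<open>w\<close> is the only intermediate string that can contribute to the entry at
    \<open>y\<close>.\<close>
  define w where "w = y[?i := False]"
  have w: "w \<in> bitstrings N" using Suc.prems by (simp add: w_def)
  have leny: "length y = N" using Suc.prems by (simp add: bitstrings_def)
  have IH: "circuit_op N (hadamard_circuit n k) z x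
      = of_bool (?P k z) / complex_of_real (sqrt 2) ^ k" if "z \<in> bitstrings N" for z
    using Suc that by simp
  have uniq: "gate_op N ([?i], hadamard) y z * circuit_op N (hadamard_circuit n k) z x
      = (if z = w then (1 / complex_of_real (sqrt 2)) * (of_bool (?P k w) / complex_of_real (sqrt 2) ^ k) else 0)"
    if z: "z \<in> bitstrings N" for z
  proof (cases "(\<forall>i<N. i \<noteq> ?i \<longrightarrow> y ! i = z ! i) \<and> ?P k z")
    case True
    then have "\<not> z ! ?i" using Suc.prems by auto
    moreover have "z = w"
    proof (rule nth_equalityI)
      show "length z = length w" using z leny by (simp add: w_def bitstrings_def)
      fix i assume "i < length z"
      then have "i < N" using z by (simp add: bitstrings_def)
      then show "z ! i = w ! i"
        using True leny \<open>\<not> z ! ?i\<close> by (cases "i = ?i") (auto simp: w_def)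
    qed
    moreover from this have "gate_op N ([?i], hadamard) y z = 1 / complex_of_real (sqrt 2)"
      using True \<open>\<not> z ! ?i\<close> unfolding gate_op_def prod.case by (subst if_P) (simp_all add: hadamard_def)
    ultimately show ?thesis
      using IH[OF z] by (simp only: if_True simp_thms)
  next
    case False
    then consider "\<not> (\<forall>i<N. i \<notin> set [?i] \<longrightarrow> y ! i = z ! i)" | "\<not> ?P k z" by auto
    then show ?thesis
    proof cases
      case 1
      then have "z \<noteq> w" using leny by (auto simp: w_def)
      moreover have "gate_op N ([?i], hadamard) y z = 0"
        using 1 unfolding gate_op_def prod.case by (rule if_not_P)
      ultimately show ?thesis by (simp only: if_False mult_zero_left)
    next
      case 2
      then have "circuit_op N (hadamard_circuit n k) z x = 0"
        using IH[OF z] by (simp only: of_bool_eq div_0)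
      moreover have "(if z = w then c * (of_bool (?P k w) / d) else 0) = 0" for c d :: complex
        using 2 by (cases "z = w") (simp_all only: of_bool_eq div_0 mult_zero_right if_cancel if_False)
      ultimately show ?thesis by (simp only: mult_zero_right)
    qed
  qed
  have "circuit_op N (hadamard_circuit n (Suc k)) y x
      = (\<Sum>z\<in>bitstrings N. gate_op N ([?i], hadamard) y z * circuit_op N (hadamard_circuit n k) z x)"
  proof -
    have "circuit_op N (hadamard_circuit n (Suc k)) y x
        = op_mult N (circuit_op N [([?i], hadamard)]) (circuit_op N (hadamard_circuit n k)) y x"
      using circuit_op_append[OF x] by (simp add: hadamard_circuit_def)
    also have "\<dots> = op_mult N (gate_op N ([?i], hadamard)) (circuit_op N (hadamard_circuit n k)) y x"
      using Suc.prems(2) by (intro op_mult_cong) (simp_all add: op_mult_id_left)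
    finally show ?thesis by (simp only: op_mult_def)
  qed
  also have "\<dots> = (1 / complex_of_real (sqrt 2)) * (of_bool (?P k w) / complex_of_real (sqrt 2) ^ k)"
    using w by (simp only: uniq sum.delta finite_bitstrings if_True cong: sum.cong)
  also have "?P k w \<longleftrightarrow> ?P (Suc k) y"
  proof
    assume P: "?P k w"
    show "?P (Suc k) y"
    proof (intro allI impI)
      fix i assume i: "i < N" "i \<notin> {n..<n + Suc k}"
      then have "i \<noteq> ?i" "i \<notin> {n..<n + k}" by auto
      then show "y ! i = x ! i" using P i leny by (auto simp: w_def nth_list_update)
    qed
  next
    assume P: "?P (Suc k) y"
    show "?P k w"
    proof (intro allI impI)
      fix i assume i: "i < N" "i \<notin> {n..<n + k}"
      show "w ! i = x ! i"
      proof (cases "i = ?i")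
        case True
        then show ?thesis using Suc.prems i leny by (auto simp: w_def)
      next
        case False
        then have "i \<notin> {n..<n + Suc k}" using i by auto
        then show ?thesis using P i leny False by (auto simp: w_def)
      qed
    qed
  qed
  finally show ?case by simp
qed


section \<open>The phase oracle\<close>

text \<open>Bits are indexed from 0 here: positions \<open>2 * j\<close> and
  \<open>Suc (2 * j)\<close> are the two bits by which the prefix grows from \<open>2 * j\<close> to
  \<open>2 * Suc j\<close> bits.\<close>

definition match_sign :: "nat \<Rightarrow> bool list \<Rightarrow> bool list \<Rightarrow> complex" where
  "match_sign j x y = (if x ! (2 * j) = y ! (2 * j) \<and> x ! Suc (2 * j) = y ! Suc (2 * j) then - 1 else 1)"

definition phase_oracle :: "(bool list \<Rightarrow> bool list) \<Rightarrow> nat \<Rightarrow> nat \<Rightarrow> qop" where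
  "phase_oracle f n j = (\<lambda>u v. match_sign j (take n v) (f (take n (drop n v))) * of_bool (u = v))"

lemma op_isometry_column:
  assumes "op_isometry N U" "x \<in> bitstrings N"
  shows "(\<Sum>y\<in>bitstrings N. (cmod (U y x))\<^sup>2) = 1"
proof -
  have "complex_of_real (\<Sum>y\<in>bitstrings N. (cmod (U y x))\<^sup>2) = op_mult N (op_adj U) U x x"
    by (simp add: op_mult_def op_adj_def complex_norm_square mult.commute del: of_real_power flip: of_real_power)
  also have "\<dots> = complex_of_real 1" using assms by (simp add: op_isometry_def op_eq_def op_id_def)
  finally show ?thesis using of_real_eq_iff by blast
qed

text \<open>The column of the unitary has total weight 1, and certainty of \<open>fx\<close> uses
  all of it up, so nothing is left for another output.\<close>

lemma certain_output_support:
  assumes "valid_circuit (n + m) C" "x \<in> bitstrings n" "fx \<in> bitstrings n"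
    and prob: "(\<Sum>w\<in>bitstrings m. (cmod (circuit_op (n + m) C (fx @ w) (x @ zeros m)))\<^sup>2) = 1"
    and "y \<in> bitstrings n" "y \<noteq> fx" "w \<in> bitstrings m"
  shows "circuit_op (n + m) C (y @ w) (x @ zeros m) = 0"
proof -
  let ?p = "\<lambda>y. \<Sum>w\<in>bitstrings m. (cmod (circuit_op (n + m) C (y @ w) (x @ zeros m)))\<^sup>2"
  have "(\<Sum>y\<in>bitstrings n. ?p y) = 1"
    using op_isometry_column[OF op_isometry_circuit_op[OF assms(1)], of "x @ zeros m"] assms(2)
    by (simp add: sum_bitstrings_add)
  then have "(\<Sum>y\<in>bitstrings n - {fx}. ?p y) = 0"
    using prob assms(3) by (simp add: sum_diff1)
  then have "?p y = 0"
    using assms(5,6) by (subst (asm) sum_nonneg_eq_0_iff) (auto intro: sum_nonneg)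
  then show ?thesis using assms(7) by (subst (asm) sum_nonneg_eq_0_iff) auto
qed

text \<open>
  After running the circuit for \<open>f\<close> the value register holds \<open>f\<close> of its old content with
  certainty, so the comparison acts as a scalar and the circuit can be undone exactly, whatever
  garbage it left on its work qubits.
\<close>

lemma implements_phase_oracle:
  assumes C: "valid_circuit (n + m) C"
    and fn: "\<And>x. x \<in> bitstrings n \<Longrightarrow> f x \<in> bitstrings n"
    and prob: "\<And>x. x \<in> bitstrings n \<Longrightarrow>
      (\<Sum>w\<in>bitstrings m. (cmod (circuit_op (n + m) C (f x @ w) (x @ zeros m)))\<^sup>2) = 1"
    and j: "j < n div 2" and "n \<le> r"
  shows "\<exists>D. implements (n + r) D (phase_oracle f n j) \<and> length D = 2 * length C + 5"
proof -
  \<comment> \<open>The circuit for \<open>f\<close> gets the second register as its input wires and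
    fresh work qubits beyond the \<open>n + r\<close> wires, so the first register, which is
    compared with the value, stays untouched.\<close>
  define ws where "ws = [n..<n + n] @ [n + r..<n + r + m]"
  define N where "N = n + r + m"
  define R where "R = relabel ws C"
  define K where "K = compare_circuit (2 * j) (Suc (2 * j)) (n + 2 * j) (n + Suc (2 * j))"
  define sg :: "bool list \<Rightarrow> complex" where
    "sg a = (if a ! (2 * j) = a ! (n + 2 * j) \<and> a ! Suc (2 * j) = a ! (n + Suc (2 * j)) then - 1 else 1)" for a
  define E where "E = circuit_op N R"
  have ws: "distinct ws" "set ws \<subseteq> {..<N}" "length ws = n + m"
    using \<open>n \<le> r\<close> by (auto simp: ws_def N_def)
  have vR: "valid_circuit N R" unfolding R_def using ws C by (intro valid_circuit_relabel) auto
  have vK: "valid_circuit N K" unfolding K_def using j \<open>n \<le> r\<close>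
    by (intro valid_compare_circuit) (auto simp: N_def)
  have K: "circuit_op N K y a = sg a * of_bool (y = a)" if "a \<in> bitstrings N" for a y
    unfolding K_def sg_def using j \<open>n \<le> r\<close> that by (intro circuit_op_compare_circuit) (auto simp: N_def)
  \<comment> \<open>Wherever the amplitude at \<open>a\<close> is nonzero, the value register of
    \<open>a\<close> holds \<open>f u\<close> and the first register is still that of
    \<open>x\<close>; so the sign is the same for all contributing \<open>a\<close>.\<close>
  have sg: "sg a * E a (x @ zeros m) = match_sign j (take n x) (f (take n (drop n x))) * E a (x @ zeros m)"
    if x: "x \<in> bitstrings (n + r)" and a: "a \<in> bitstrings N" for x a
  proof (cases "E a (x @ zeros m) = 0")
    case False
    define u where "u = take n (drop n x)"
    have u: "u \<in> bitstrings n" using x \<open>n \<le> r\<close> by (simp add: u_def bitstrings_def)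
    have xz: "x @ zeros m \<in> bitstrings N" using x by (simp add: N_def)
    have lx: "length x = n + r" using x by (simp add: bitstrings_def)
    have mx: "map ((!) (x @ zeros m)) ws = u @ zeros m"
      using lx \<open>n \<le> r\<close> by (intro nth_equalityI) (auto simp: ws_def u_def nth_append)
    have "E a (x @ zeros m) = gate_op N (ws, circuit_op (n + m) C) a (x @ zeros m)"
      using circuit_op_relabel[of ws N C a "x @ zeros m"] ws C a xz by (simp add: E_def R_def)
    with False have agree: "\<forall>i<N. i \<notin> set ws \<longrightarrow> a ! i = (x @ zeros m) ! i"
      and nz: "circuit_op (n + m) C (map ((!) a) ws) (u @ zeros m) \<noteq> 0"
      by (auto simp: gate_op_def mx split: if_splits)
    have "map ((!) a) ws \<in> bitstrings (n + m)" using ws(3) by (simp add: bitstrings_def)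
    then obtain y w where yw: "map ((!) a) ws = y @ w" "y \<in> bitstrings n" "w \<in> bitstrings m"
      by (rule bitstrings_addE)
    have "y = f u"
      using certain_output_support[OF C u fn[OF u] prob[OF u] yw(2) _ yw(3)] nz yw(1) by auto
    have fu: "a ! (n + t) = f u ! t" if "t < n" for t
    proof -
      have "f u ! t = (y @ w) ! t" using that yw(2) \<open>y = f u\<close> by (simp add: nth_append bitstrings_def)
      also have "\<dots> = a ! (ws ! t)" using that ws(3) yw(1)[symmetric] by simp
      also have "ws ! t = n + t" using that by (simp add: ws_def nth_append)
      finally show ?thesis by simp
    qed
    have "a ! t = x ! t" if "t < n" for t
      using agree that lx \<open>n \<le> r\<close> by (auto simp: N_def ws_def nth_append)
    then have "sg a = match_sign j (take n x) (f u)"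
      using j fu[of "2 * j"] fu[of "Suc (2 * j)"] by (simp add: sg_def match_sign_def)
    then show ?thesis by (simp add: u_def)
  qed simp
  have "implements (n + r) (R @ K @ inverse_circuit R) (phase_oracle f n j)"
  proof (rule implementsI[of _ m])
    show "valid_circuit (n + r + m) (R @ K @ inverse_circuit R)"
      using vR vK valid_inverse_circuit by (simp add: N_def)
    fix x y w
    assume x: "x \<in> bitstrings (n + r)" and y: "y \<in> bitstrings (n + r)" and w: "w \<in> bitstrings m"
    define s where "s = match_sign j (take n x) (f (take n (drop n x)))"
    have xz: "x @ zeros m \<in> bitstrings N" and yw: "y @ w \<in> bitstrings N"
      using x y w by (simp_all add: N_def)
    have KR: "circuit_op N (K @ inverse_circuit R) (y @ w) a = op_adj E (y @ w) a * sg a"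
      if a: "a \<in> bitstrings N" for a
    proof -
      have "circuit_op N (K @ inverse_circuit R) (y @ w) a
          = (\<Sum>b\<in>bitstrings N. op_adj E (y @ w) b * (sg a * of_bool (b = a)))"
        using a yw by (simp add: circuit_op_append op_mult_def circuit_op_inverse_circuit K E_def)
      also have "\<dots> = op_adj E (y @ w) a * sg a"
        using a by (simp add: of_bool_def if_distrib if_distribR cong: if_cong)
      finally show ?thesis .
    qed
    have "circuit_op N (R @ K @ inverse_circuit R) (y @ w) (x @ zeros m)
        = (\<Sum>a\<in>bitstrings N. op_adj E (y @ w) a * (sg a * E a (x @ zeros m)))"
      unfolding circuit_op_append[OF xz] op_mult_def E_def[symmetric]
      by (intro sum.cong refl) (simp only: KR mult.assoc)
    also have "\<dots> = (\<Sum>a\<in>bitstrings N. s * (op_adj E (y @ w) a * E a (x @ zeros m)))"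
      using sg[OF x] by (intro sum.cong refl) (simp add: s_def)
    also have "\<dots> = s * op_mult N (op_adj E) E (y @ w) (x @ zeros m)"
      by (simp only: op_mult_def sum_distrib_left)
    also have "\<dots> = s * op_id (y @ w) (x @ zeros m)"
      using op_isometry_circuit_op[OF vR] xz yw by (simp add: op_isometry_def op_eq_def E_def)
    also have "\<dots> = phase_oracle f n j y x * of_bool (w = zeros m)"
      using x y by (simp add: op_id_def phase_oracle_def s_def bitstrings_def)
    finally show "circuit_op (n + r + m) (R @ K @ inverse_circuit R) (y @ w) (x @ zeros m)
        = phase_oracle f n j y x * of_bool (w = zeros m)" by (simp add: N_def)
  qed
  moreover have "length (R @ K @ inverse_circuit R) = 2 * length C + 5"
    by (simp add: R_def K_def compare_circuit_def)
  ultimately show ?thesis by blast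
qed


section \<open>The ideal run\<close>

text \<open>\<open>|x\<rangle> \<otimes> \<psi> \<otimes> |0\<rangle>\<close> on registers of \<open>n\<close>, \<open>n\<close> and \<open>a\<close> qubits\<close>

definition reg_state :: "nat \<Rightarrow> nat \<Rightarrow> bool list \<Rightarrow> state \<Rightarrow> state" where
  "reg_state n a x \<psi> = (\<lambda>z. of_bool (take n z = x) * \<psi> (take n (drop n z)) *
     of_bool (drop (n + n) z = zeros a))"

lemma reg_state_append:
  "y \<in> bitstrings n \<Longrightarrow> u \<in> bitstrings n \<Longrightarrow>
    reg_state n a x \<psi> (y @ u @ w) = of_bool (y = x) * \<psi> u * of_bool (w = zeros a)"
  by (simp add: reg_state_def bitstrings_def)

lemma bitstrings_registersE:
  assumes "z \<in> bitstrings (n + (n + a))"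
  obtains y u w where "z = y @ u @ w" "y \<in> bitstrings n" "u \<in> bitstrings n" "w \<in> bitstrings a"
  using assms by (metis bitstrings_addE)

lemma op_app_reg_state:
  assumes "x \<in> bitstrings n"
  shows "op_app (n + (n + a)) U (reg_state n a x \<psi>) z
    = (\<Sum>u\<in>bitstrings n. U z (x @ u @ zeros a) * \<psi> u)"
proof -
  have "op_app (n + (n + a)) U (reg_state n a x \<psi>) z
     = (\<Sum>y\<in>bitstrings n. \<Sum>u\<in>bitstrings n. \<Sum>w\<in>bitstrings a.
          if w = zeros a then if y = x then U z (y @ u @ w) * \<psi> u else 0 else 0)"
    unfolding op_app_def sum_bitstrings_add by (intro sum.cong refl) (simp add: reg_state_append)
  also have "\<dots> = (\<Sum>y\<in>bitstrings n. \<Sum>u\<in>bitstrings n.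
          if y = x then U z (y @ u @ zeros a) * \<psi> u else 0)"
    by (simp only: sum.delta finite_bitstrings zeros_in_bitstrings if_True)
  also have "\<dots> = (\<Sum>y\<in>bitstrings n. if y = x then
          \<Sum>u\<in>bitstrings n. U z (y @ u @ zeros a) * \<psi> u else 0)"
    by (intro sum.cong refl) simp
  also have "\<dots> = (\<Sum>u\<in>bitstrings n. U z (x @ u @ zeros a) * \<psi> u)"
    using assms by (simp only: sum.delta finite_bitstrings if_True)
  finally show ?thesis .
qed

lemma qnorm_reg_state:
  assumes "x \<in> bitstrings n"
  shows "(qnorm (n + (n + a)) (reg_state n a x \<psi>))\<^sup>2 = (\<Sum>u\<in>bitstrings n. (cmod (\<psi> u))\<^sup>2)"
proof -
  have "(qnorm (n + (n + a)) (reg_state n a x \<psi>))\<^sup>2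
     = (\<Sum>y\<in>bitstrings n. \<Sum>u\<in>bitstrings n. \<Sum>w\<in>bitstrings a.
          (if y = x then if w = zeros a then (cmod (\<psi> u))\<^sup>2 else 0 else 0))"
    unfolding qnorm_power2 sum_bitstrings_add by (intro sum.cong refl) (simp add: reg_state_append)
  also have "\<dots> = (\<Sum>y\<in>bitstrings n. if y = x then \<Sum>u\<in>bitstrings n. (cmod (\<psi> u))\<^sup>2 else 0)"
    by (intro sum.cong refl) simp
  also have "\<dots> = (\<Sum>u\<in>bitstrings n. (cmod (\<psi> u))\<^sup>2)" using assms by simp
  finally show ?thesis .
qed

lemma op_app_phase_oracle:
  assumes "z \<in> bitstrings (n + (n + a))" "x \<in> bitstrings n"
  shows "op_app (n + (n + a)) (phase_oracle f n j) (reg_state n a x \<psi>) z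
    = reg_state n a x (\<lambda>u. match_sign j x (f u) * \<psi> u) z"
proof -
  have "op_app (n + (n + a)) (phase_oracle f n j) (reg_state n a x \<psi>) z
      = match_sign j (take n z) (f (take n (drop n z))) * reg_state n a x \<psi> z"
    using assms by (simp add: op_app_def phase_oracle_def of_bool_def if_distrib if_distribR cong: if_cong)
  then show ?thesis by (simp add: reg_state_def)
qed

lemma reflection_op_entry:
  assumes "y \<in> bitstrings n" "v \<in> bitstrings n" "x \<in> bitstrings n" "u \<in> bitstrings n"
  shows "reflection_op f n j (y @ v) (x @ u) = of_bool (y = x) *
    (2 * (prefix_state f n j x v * cnj (prefix_state f n j x u)) - of_bool (v = u))"
proof -
  have "reflection_op f n j (y @ v) (x @ u) = (\<Sum>x'\<in>bitstrings n. if x' = x then of_bool (y = x) *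
    (2 * (prefix_state f n j x v * cnj (prefix_state f n j x u)) - of_bool (v = u)) else 0)"
    unfolding reflection_op_def using assms
    by (intro sum.cong refl) (auto simp: op_tensor_def outer_def ket_def op_id_def bitstrings_def)
  then show ?thesis using assms(3) by simp
qed

lemma op_app_reflection:
  assumes "z \<in> bitstrings (n + (n + a))" "x \<in> bitstrings n"
  shows "op_app (n + (n + a)) (op_tensor (2 * n) (reflection_op f n j) op_id) (reg_state n a x \<psi>) z
    = reg_state n a x (\<lambda>v. 2 * (\<Sum>u\<in>bitstrings n. cnj (prefix_state f n j x u) * \<psi> u)
        * prefix_state f n j x v - \<psi> v) z"
proof -
  obtain y v w where z: "z = y @ v @ w" "y \<in> bitstrings n" "v \<in> bitstrings n" "w \<in> bitstrings a"
    using assms(1) by (rule bitstrings_registersE)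
  let ?p = "prefix_state f n j x"
  have "op_app (n + (n + a)) (op_tensor (2 * n) (reflection_op f n j) op_id) (reg_state n a x \<psi>) z
      = (\<Sum>u\<in>bitstrings n. reflection_op f n j (y @ v) (x @ u) * of_bool (w = zeros a) * \<psi> u)"
    unfolding op_app_reg_state[OF assms(2)] using z assms(2)
    by (intro sum.cong refl) (simp add: op_tensor_def op_id_def bitstrings_def mult_2)
  also have "\<dots> = (\<Sum>u\<in>bitstrings n. of_bool (y = x) * of_bool (w = zeros a) *
      (2 * (cnj (?p u) * \<psi> u) * ?p v - (if v = u then \<psi> v else 0)))"
    using z assms(2) by (intro sum.cong refl) (auto simp: reflection_op_entry algebra_simps)
  also have "\<dots> = of_bool (y = x) * of_bool (w = zeros a) *
      (2 * (\<Sum>u\<in>bitstrings n. cnj (?p u) * \<psi> u) * ?p v - \<psi> v)"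
    using z(3) by (simp add: sum_subtractf flip: sum_distrib_left sum_distrib_right)
  finally show ?thesis using z by (simp add: reg_state_append mult_ac)
qed

lemma prefix_state_eq:
  "u \<in> bitstrings n \<Longrightarrow> prefix_state f n j x u
    = complex_of_real (1 / sqrt (2 ^ (n - 2 * j))) * of_bool (take (2 * j) (f u) = take (2 * j) x)"
  by (simp add: prefix_state_def ket_def of_bool_def)

text \<open>Since \<open>f\<close> is a bijection, it suffices to count the completions of the
  prefix.\<close>

lemma card_prefix_preimage:
  assumes "bij_betw f (bitstrings n) (bitstrings n)" "x \<in> bitstrings n" "k \<le> n"
  shows "card {u \<in> bitstrings n. take k (f u) = take k x} = 2 ^ (n - k)"
proof -
  let ?A = "{u \<in> bitstrings n. take k (f u) = take k x}"
  have "card ?A = card (f ` ?A)"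
    using assms(1) by (intro card_image[symmetric]) (auto simp: bij_betw_def intro: inj_on_subset)
  also have "f ` ?A = (\<lambda>w. take k x @ w) ` bitstrings (n - k)"
  proof (intro equalityI subsetI)
    fix y assume "y \<in> f ` ?A"
    then have y: "y \<in> bitstrings n" "take k y = take k x"
      using assms(1) by (auto simp: bij_betw_def)
    then have "y = take k x @ drop k y" "drop k y \<in> bitstrings (n - k)"
      by (auto simp: bitstrings_def) (metis append_take_drop_id)
    then show "y \<in> (\<lambda>w. take k x @ w) ` bitstrings (n - k)" by blast
  next
    fix y assume "y \<in> (\<lambda>w. take k x @ w) ` bitstrings (n - k)"
    then have y: "y \<in> bitstrings n" "take k y = take k x"
      using assms(2,3) by (auto simp: bitstrings_def)
    then obtain u where "u \<in> bitstrings n" "y = f u" using assms(1) by (auto simp: bij_betw_def)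
    then show "y \<in> f ` ?A" using y by auto
  qed
  also have "card \<dots> = 2 ^ (n - k)"
    by (subst card_image) (auto simp: inj_on_def card_bitstrings)
  finally show ?thesis .
qed

lemma take_Suc_Suc_eq_iff:
  assumes "length x = length y" "Suc (Suc k) \<le> length x"
  shows "take (Suc (Suc k)) y = take (Suc (Suc k)) x
    \<longleftrightarrow> take k y = take k x \<and> x ! k = y ! k \<and> x ! Suc k = y ! Suc k"
proof -
  have "take (Suc (Suc k)) z = take k z @ [z ! k, z ! Suc k]" if "Suc (Suc k) \<le> length z" for z :: "'a list"
    using that by (simp add: take_Suc_conv_app_nth)
  from this[of x] this[of y] show ?thesis using assms by auto
qed

text \<open>
  One Grover iteration is exact, because the marked strings make up a quarter of the prefix state.
\<close>

lemma grover_step: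
  assumes f: "bij_betw f (bitstrings n) (bitstrings n)" and x: "x \<in> bitstrings n"
    and j: "j < n div 2" and v: "v \<in> bitstrings n"
  defines "s \<equiv> \<lambda>u. match_sign j x (f u) * prefix_state f n j x u"
  shows "2 * (\<Sum>u\<in>bitstrings n. cnj (prefix_state f n j x u) * s u) * prefix_state f n j x v - s v
    = prefix_state f n (Suc j) x v"
proof -
  define B where "B i = {u \<in> bitstrings n. take (2 * i) (f u) = take (2 * i) x}" for i
  obtain k where k: "n - 2 * j = Suc (Suc k)"
  proof
    show "n - 2 * j = Suc (Suc (n - 2 * j - 2))" using j by linarith
  qed
  have k': "n - 2 * Suc j = k" using k by simp
  \<comment> \<open>\<open>c\<close> is the amplitude of the next prefix state; the present one has
    four times as many strings, hence amplitude \<open>c / 2\<close>.\<close>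
  define c where "c = 1 / sqrt (2 ^ k)"
  have c2: "c * c = 1 / 2 ^ k" by (simp add: c_def flip: power2_eq_square) (simp add: power_divide)
  have half: "1 / sqrt (2 ^ (n - 2 * j)) = c / 2"
    unfolding k c_def by (simp add: real_sqrt_mult flip: mult.assoc)
  have psi: "prefix_state f n j x u = complex_of_real (c / 2) * of_bool (u \<in> B j)"
    "prefix_state f n (Suc j) x u = complex_of_real c * of_bool (u \<in> B (Suc j))"
    if "u \<in> bitstrings n" for u
    using that half k' by (simp_all add: prefix_state_eq B_def c_def)
  have iff: "u \<in> B (Suc j) \<longleftrightarrow> u \<in> B j \<and> match_sign j x (f u) = - 1"
    if u: "u \<in> bitstrings n" for u
  proof -
    have "f u \<in> bitstrings n" using f u by (auto simp: bij_betw_def)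
    then show ?thesis
      using take_Suc_Suc_eq_iff[of x "f u" "2 * j"] x j u
      by (auto simp: B_def match_sign_def bitstrings_def)
  qed
  have sgn: "match_sign j x (f u) = (if u \<in> B (Suc j) then - 1 else 1)" if "u \<in> B j" for u
    using iff[of u] that by (auto simp: B_def match_sign_def)
  have sub: "B (Suc j) \<subseteq> B j" using iff by (auto simp: B_def)
  have fin: "finite (B i)" for i by (simp add: B_def)
  have card: "card (B j) = 4 * 2 ^ k" "card (B (Suc j)) = 2 ^ k"
    using card_prefix_preimage[OF f x, of "2 * j"] card_prefix_preimage[OF f x, of "2 * Suc j"] j k k'
    by (simp_all add: B_def)
  \<comment> \<open>Three quarters of the weight keep their sign and one quarter is flipped, so the
    overlap is \<open>3/4 - 1/4 = 1/2\<close>.\<close>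
  have "(\<Sum>u\<in>bitstrings n. cnj (prefix_state f n j x u) * s u)
      = (\<Sum>u\<in>B j. complex_of_real (c / 2 * (c / 2)) * (1 - 2 * of_bool (u \<in> B (Suc j))))"
  proof (rule sum.mono_neutral_cong_right)
    show "B j \<subseteq> bitstrings n" by (auto simp: B_def)
    fix u assume "u \<in> B j"
    moreover from this have "u \<in> bitstrings n" by (simp add: B_def)
    ultimately show "cnj (prefix_state f n j x u) * s u
        = complex_of_real (c / 2 * (c / 2)) * (1 - 2 * of_bool (u \<in> B (Suc j)))"
      by (simp add: s_def psi sgn)
  qed (auto simp: psi)
  also have "\<dots> = complex_of_real (c / 2 * (c / 2)) * (of_nat (card (B j)) - 2 * of_nat (card (B (Suc j))))"
  proof -
    have "(\<Sum>u\<in>B j. of_bool (u \<in> B (Suc j))) = (of_nat (card (B (Suc j))) :: complex)"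
      using sub fin by (simp add: of_bool_def sum.If_cases Int_absorb1)
    then show ?thesis
      by (simp only: sum_subtractf sum_constant mult_1_right flip: sum_distrib_left)
  qed
  also have "\<dots> = complex_of_real (c * c * 2 ^ k / 2)" by (simp add: card)
  also have "\<dots> = 1 / 2" by (simp add: c2)
  finally have inner: "(\<Sum>u\<in>bitstrings n. cnj (prefix_state f n j x u) * s u) = 1 / 2" .
  \<comment> \<open>With overlap 1/2 the reflection of \<open>s\<close> is the prefix state minus
    \<open>s\<close>: unmarked amplitudes cancel, marked ones become
    \<open>c / 2 + c / 2 = c\<close>.\<close>
  show ?thesis
  proof (cases "v \<in> B j")
    case True
    show ?thesis
      unfolding inner unfolding s_def psi[OF v] sgn[OF True] using True
      by (cases "v \<in> B (Suc j)") simp_all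
  next
    case False
    then have "v \<notin> B (Suc j)" using sub by blast
    then show ?thesis
      unfolding inner unfolding s_def psi[OF v] using False by simp
  qed
qed


section \<open>The error of a pseudo identity\<close>

text \<open>With \<open>G\<close> for this operator,
  \<open>G\<^sup>\<dagger> G = I \<otimes> J J\<^sup>\<dagger>\<close>; it is the second half of
  \<open>op_unitary\<close> that enters.\<close>

lemma op_isometry_adj_tensor:
  assumes "op_unitary b J"
  shows "op_isometry (a + b) (op_adj (op_tensor a op_id J))"
  unfolding op_isometry_def
proof (rule op_eqI)
  fix x y assume xy: "x \<in> bitstrings (a + b)" "y \<in> bitstrings (a + b)"
  have adj_id: "op_adj op_id = op_id" by (auto simp: op_adj_def op_id_def fun_eq_iff)
  have mem: "take a x \<in> bitstrings a" "drop a x \<in> bitstrings b" "drop a y \<in> bitstrings b"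
    using xy by (simp_all add: bitstrings_def)
  have "op_mult (a + b) (op_adj (op_adj (op_tensor a op_id J))) (op_adj (op_tensor a op_id J)) x y
      = op_mult a op_id op_id (take a x) (take a y) * op_mult b J (op_adj J) (drop a x) (drop a y)"
    using xy by (simp add: op_adj_tensor adj_id op_mult_tensor) (simp add: op_tensor_def)
  also have "\<dots> = op_id (take a x) (take a y) * op_id (drop a x) (drop a y)"
    using assms mem by (simp add: op_mult_id_left op_unitary_def op_eq_def)
  also have "\<dots> = op_id x y" by (auto simp: op_id_def) (metis append_take_drop_id)
  finally show "op_mult (a + b) (op_adj (op_adj (op_tensor a op_id J)))
      (op_adj (op_tensor a op_id J)) x y = op_id x y" .
qed

text \<open>Both \<open>G |k\<rangle>\<close> and \<open>|k\<rangle>\<close> are unit vectors, so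
  their distance depends only on the real part of one diagonal entry. In this way a bound on the
  diagonal of \<open>J\<close> also controls what leaks into other basis states, ancillas
  included.\<close>

lemma isometry_ket_deviation:
  assumes "op_isometry N G" "k \<in> bitstrings N"
  shows "(qnorm N (\<lambda>z. G z k - op_id z k))\<^sup>2 = 2 * (1 - Re (G k k))"
proof -
  have "(cmod (G z k - op_id z k))\<^sup>2 = (cmod (G z k))\<^sup>2 + (if z = k then 1 - 2 * Re (G k k) else 0)"
    for z
    unfolding op_id_def cmod_power2 by (simp add: power2_eq_square algebra_simps)
  then have "(qnorm N (\<lambda>z. G z k - op_id z k))\<^sup>2
      = (\<Sum>z\<in>bitstrings N. (cmod (G z k))\<^sup>2) + (\<Sum>z\<in>bitstrings N. if z = k then 1 - 2 * Re (G k k) else 0)"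
    by (simp only: qnorm_power2 sum.distrib)
  then show ?thesis using op_isometry_column[OF assms] assms(2) by simp
qed

lemma sum_power2_le: "(x + y)\<^sup>2 \<le> 2 * x\<^sup>2 + 2 * y\<^sup>2" for x y :: real
  using zero_le_power2[of "x - y"] by (simp add: power2_eq_square algebra_simps)

text \<open>The state is split at \<open>X\<close>. Off \<open>X\<close> every basis state moves by
  at most \<open>sqrt (2 * \<alpha>)\<close>, and the triangle inequality over at most
  \<open>2 ^ n\<close> of them gives the square \<open>2 * \<alpha> * 4 ^ n\<close>. On
  \<open>X\<close> nothing is known but norm preservation, so the deviation is at most twice the
  norm. Squaring the sum doubles both squares.\<close>

lemma pseudo_identity_deviation:
  fixes J :: qop and n a :: nat
  defines "G \<equiv> op_adj (op_tensor n op_id J)"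
  assumes J: "op_unitary (n + a) J" and X: "X \<subseteq> bitstrings n" and "0 \<le> \<alpha>"
    and close: "\<And>z. z \<in> bitstrings n - X \<Longrightarrow> cmod (1 - J (z @ zeros a) (z @ zeros a)) \<le> \<alpha>"
    and x: "x \<in> bitstrings n" and \<psi>: "\<And>u. u \<in> bitstrings n \<Longrightarrow> cmod (\<psi> u) \<le> 1"
  shows "(qnorm (n + (n + a)) (\<lambda>z. op_app (n + (n + a)) G (reg_state n a x \<psi>) z - reg_state n a x \<psi> z))\<^sup>2
    \<le> 4 * \<alpha> * 4 ^ n + 8 * (\<Sum>u\<in>X. (cmod (\<psi> u))\<^sup>2)"
proof -
  let ?N = "n + (n + a)"
  let ?D = "\<lambda>\<psi> z. op_app ?N G (reg_state n a x \<psi>) z - reg_state n a x \<psi> z"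
  let ?d = "\<lambda>u z. G z (x @ u @ zeros a) - op_id z (x @ u @ zeros a)"
  define \<psi>1 \<psi>2 where "\<psi>1 u = (if u \<in> X then 0 else \<psi> u)" and "\<psi>2 u = (if u \<in> X then \<psi> u else 0)" for u
  have G: "op_isometry ?N G" unfolding G_def by (rule op_isometry_adj_tensor[OF J])
  have id: "reg_state n a x \<phi> z = op_app ?N op_id (reg_state n a x \<phi>) z" if "z \<in> bitstrings ?N" for \<phi> z
    using that by (simp add: op_app_def op_id_def of_bool_def if_distrib if_distribR cong: if_cong)
  have D: "?D \<phi> z = (\<Sum>u\<in>bitstrings n. \<phi> u * ?d u z)" if "z \<in> bitstrings ?N" for \<phi> z
    unfolding id[OF that, of \<phi>] op_app_reg_state[OF x]
    by (simp add: sum_subtractf algebra_simps)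
  have small: "qnorm ?N (?d u) \<le> sqrt (2 * \<alpha>)" if u: "u \<in> bitstrings n - X" for u
  proof (rule real_le_rsqrt)
    have k: "x @ u @ zeros a \<in> bitstrings ?N" using x u by simp
    have "G (x @ u @ zeros a) (x @ u @ zeros a) = cnj (J (u @ zeros a) (u @ zeros a))"
      using x by (simp add: G_def op_adj_def op_tensor_def op_id_def bitstrings_def)
    moreover have "1 - Re (J (u @ zeros a) (u @ zeros a)) \<le> \<alpha>"
      using close[OF u] complex_Re_le_cmod[of "1 - J (u @ zeros a) (u @ zeros a)"] by simp
    ultimately show "(qnorm ?N (?d u))\<^sup>2 \<le> 2 * \<alpha>"
      by (simp add: isometry_ket_deviation[OF G k])
  qed
  have "qnorm ?N (?D \<psi>1) = qnorm ?N (\<lambda>z. \<Sum>u\<in>bitstrings n - X. \<psi> u * ?d u z)"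
  proof (rule qnorm_cong)
    fix z assume "z \<in> bitstrings ?N"
    then have "?D \<psi>1 z = (\<Sum>u\<in>bitstrings n. \<psi>1 u * ?d u z)" by (rule D)
    also have "\<dots> = (\<Sum>u\<in>bitstrings n - X. \<psi> u * ?d u z)"
      by (rule sum.mono_neutral_cong_right) (auto simp: \<psi>1_def)
    finally show "?D \<psi>1 z = (\<Sum>u\<in>bitstrings n - X. \<psi> u * ?d u z)" .
  qed
  also have "\<dots> \<le> (\<Sum>u\<in>bitstrings n - X. qnorm ?N (\<lambda>z. \<psi> u * ?d u z))"
    by (rule qnorm_sum_le) simp
  also have "\<dots> \<le> (\<Sum>u\<in>bitstrings n - X. sqrt (2 * \<alpha>))"
  proof (rule sum_mono)
    fix u assume u: "u \<in> bitstrings n - X"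
    then have "cmod (\<psi> u) * qnorm ?N (?d u) \<le> 1 * sqrt (2 * \<alpha>)"
      using \<psi> small by (intro mult_mono) auto
    then show "qnorm ?N (\<lambda>z. \<psi> u * ?d u z) \<le> sqrt (2 * \<alpha>)" by (simp add: qnorm_scale)
  qed
  also have "\<dots> \<le> (\<Sum>u\<in>bitstrings n. sqrt (2 * \<alpha>))"
    using \<open>0 \<le> \<alpha>\<close> by (intro sum_mono2) auto
  also have "\<dots> = 2 ^ n * sqrt (2 * \<alpha>)" by (simp add: card_bitstrings)
  finally have "(qnorm ?N (?D \<psi>1))\<^sup>2 \<le> (2 ^ n * sqrt (2 * \<alpha>))\<^sup>2"
    by (intro power_mono) simp_all
  also have "\<dots> = 2 * \<alpha> * 4 ^ n"
  proof -
    have "(2 ^ n)\<^sup>2 = (4 :: real) ^ n" by (simp add: power2_eq_square flip: power_mult_distrib)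
    then show ?thesis using \<open>0 \<le> \<alpha>\<close> by (simp add: power_mult_distrib)
  qed
  finally have d1: "(qnorm ?N (?D \<psi>1))\<^sup>2 \<le> 2 * \<alpha> * 4 ^ n" .
  have "qnorm ?N (?D \<psi>2) \<le> 2 * qnorm ?N (reg_state n a x \<psi>2)"
    using qnorm_diff_le[of ?N "op_app ?N G (reg_state n a x \<psi>2)" "reg_state n a x \<psi>2"]
    by (simp add: qnorm_op_app[OF G])
  then have "(qnorm ?N (?D \<psi>2))\<^sup>2 \<le> (2 * qnorm ?N (reg_state n a x \<psi>2))\<^sup>2"
    by (intro power_mono) simp_all
  also have "\<dots> = 4 * (\<Sum>u\<in>bitstrings n. (cmod (\<psi>2 u))\<^sup>2)"
    by (simp add: power_mult_distrib qnorm_reg_state[OF x])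
  also have "(\<Sum>u\<in>bitstrings n. (cmod (\<psi>2 u))\<^sup>2) = (\<Sum>u\<in>X. (cmod (\<psi> u))\<^sup>2)"
    using X by (intro sum.mono_neutral_cong_right) (auto simp: \<psi>2_def)
  finally have d2: "(qnorm ?N (?D \<psi>2))\<^sup>2 \<le> 4 * (\<Sum>u\<in>X. (cmod (\<psi> u))\<^sup>2)" .
  have "qnorm ?N (?D \<psi>) = qnorm ?N (\<lambda>z. ?D \<psi>1 z + ?D \<psi>2 z)"
  proof (rule qnorm_cong)
    fix z assume z: "z \<in> bitstrings ?N"
    have "(\<Sum>u\<in>bitstrings n. \<psi> u * ?d u z)
        = (\<Sum>u\<in>bitstrings n. \<psi>1 u * ?d u z) + (\<Sum>u\<in>bitstrings n. \<psi>2 u * ?d u z)"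
      unfolding sum.distrib[symmetric] by (intro sum.cong refl) (simp add: \<psi>1_def \<psi>2_def)
    then show "?D \<psi> z = ?D \<psi>1 z + ?D \<psi>2 z" by (simp only: D[OF z])
  qed
  then have "(qnorm ?N (?D \<psi>))\<^sup>2 \<le> (qnorm ?N (?D \<psi>1) + qnorm ?N (?D \<psi>2))\<^sup>2"
    using qnorm_add_le by (intro power_mono) simp_all
  also have "\<dots> \<le> 2 * (qnorm ?N (?D \<psi>1))\<^sup>2 + 2 * (qnorm ?N (?D \<psi>2))\<^sup>2"
    by (rule sum_power2_le)
  finally show ?thesis using d1 d2 by linarith
qed

text \<open>
  With \<open>G\<close> the adjoint of \<open>I \<otimes> J\<close>, the conjugated reflection maps \<open>G u\<close> to \<open>G (Q u)\<close>; hence only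
  the deviations of \<open>G\<close> from the identity on \<open>u\<close> and on \<open>Q u\<close> enter.
\<close>

lemma conj_reflection_deviation:
  fixes J :: qop and n a :: nat
  defines "G \<equiv> op_adj (op_tensor n op_id J)"
  defines "N \<equiv> n + (n + a)"
  assumes J: "op_unitary (n + a) J"
    and T: "op_isometry N (conj_reflection_op f n (n + a) J j)"
    and Q: "\<And>z. z \<in> bitstrings N \<Longrightarrow>
      op_app N (op_tensor (2 * n) (reflection_op f n j) op_id) u z = v z"
  shows "qnorm N (\<lambda>z. op_app N (conj_reflection_op f n (n + a) J j) u z - v z)
    \<le> qnorm N (\<lambda>z. op_app N G u z - u z) + qnorm N (\<lambda>z. op_app N G v z - v z)"
proof -
  let ?T = "conj_reflection_op f n (n + a) J j"
  have G: "op_isometry N G" unfolding G_def N_def by (rule op_isometry_adj_tensor[OF J])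
  have IJ: "op_app N (op_tensor n op_id J) (op_app N G u) z = u z" if z: "z \<in> bitstrings N" for z
  proof -
    have "op_app N (op_tensor n op_id J) (op_app N G u) z = op_app N (op_mult N (op_adj G) G) u z"
      by (simp add: op_app_mult G_def)
    also have "\<dots> = op_app N op_id u z"
      using G z by (simp add: op_app_def op_isometry_def op_eq_def)
    also have "\<dots> = u z"
      using z by (simp add: op_app_def op_id_def of_bool_def if_distrib if_distribR cong: if_cong)
    finally show ?thesis .
  qed
  have TG: "op_app N ?T (op_app N G u) = op_app N G v"
  proof -
    have "op_app N ?T (op_app N G u) = op_app N G (op_app N (op_tensor (2 * n) (reflection_op f n j) op_id)
        (op_app N (op_tensor n op_id J) (op_app N G u)))"
      by (simp add: conj_reflection_op_def N_def G_def op_app_mult)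
    also have "op_app N (op_tensor (2 * n) (reflection_op f n j) op_id)
        (op_app N (op_tensor n op_id J) (op_app N G u))
        = op_app N (op_tensor (2 * n) (reflection_op f n j) op_id) u"
      by (rule op_app_cong) (rule IJ)
    also have "op_app N G \<dots> = op_app N G v" by (rule op_app_cong) (rule Q)
    finally show ?thesis .
  qed
  \<comment> \<open>As \<open>?T\<close> maps \<open>G u\<close> to \<open>G v\<close>, this
    difference is \<open>?T\<close> applied to \<open>u - G u\<close>, and \<open>?T\<close>
    preserves its norm.\<close>
  have "qnorm N (\<lambda>z. op_app N ?T u z - op_app N G v z) = qnorm N (op_app N ?T (\<lambda>z. u z - op_app N G u z))"
    by (simp add: op_app_diff TG)
  also have "\<dots> = qnorm N (\<lambda>z. op_app N G u z - u z)"
    by (simp add: qnorm_op_app[OF T] qnorm_minus_commute[of N u])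
  finally show ?thesis
    using qnorm_triangle[of N "op_app N ?T u" v "op_app N G v"] by simp
qed


section \<open>The inversion circuit\<close>

text \<open>The bound of \<open>pseudo_identity_deviation\<close> for a prefix state; it bounds a
  squared deviation, whence the square roots in what follows.\<close>

definition step_error :: "(bool list \<Rightarrow> bool list) \<Rightarrow> nat \<Rightarrow> bool list set \<Rightarrow> real
    \<Rightarrow> nat \<Rightarrow> bool list \<Rightarrow> real" where
  "step_error f n X \<alpha> j x = 4 * \<alpha> * 4 ^ n + 8 * (\<Sum>u\<in>X. (cmod (prefix_state f n j x u))\<^sup>2)"

lemma step_error_nonneg: "0 \<le> \<alpha> \<Longrightarrow> 0 \<le> step_error f n X \<alpha> j x"
  by (auto simp: step_error_def intro!: add_nonneg_nonneg sum_nonneg)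

lemma cmod_prefix_state_le: "u \<in> bitstrings n \<Longrightarrow> cmod (prefix_state f n j x u) \<le> 1"
  by (simp add: prefix_state_eq of_bool_def norm_divide norm_power real_sqrt_power)

lemma cmod_match_sign [simp]: "cmod (match_sign j x y) = 1"
  by (simp add: match_sign_def)

text \<open>Fix \<open>u\<close> and sum over \<open>x\<close>: exactly the
  \<open>2 ^ (n - 2 * j)\<close> strings \<open>x\<close> that share their prefix with
  \<open>f u\<close> contribute, each with squared amplitude \<open>1 / 2 ^ (n - 2 * j)\<close>. So
  each element of \<open>X\<close> has total weight 1, whatever \<open>j\<close> is.\<close>

lemma sum_step_error:
  assumes f: "bij_betw f (bitstrings n) (bitstrings n)" and X: "X \<subseteq> bitstrings n"
    and "2 * j \<le> n"
  shows "(\<Sum>x\<in>bitstrings n. step_error f n X \<alpha> j x) = 2 ^ n * (4 * \<alpha> * 4 ^ n) + 8 * real (card X)"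
proof -
  have "(\<Sum>x\<in>bitstrings n. (cmod (prefix_state f n j x u))\<^sup>2) = 1" if u: "u \<in> X" for u
  proof -
    have fu: "f u \<in> bitstrings n" using f X u by (auto simp: bij_betw_def)
    have "(\<Sum>x\<in>bitstrings n. (cmod (prefix_state f n j x u))\<^sup>2)
        = (\<Sum>x\<in>bitstrings n. if take (2 * j) x = take (2 * j) (f u) then 1 / 2 ^ (n - 2 * j) else 0)"
      using X u by (intro sum.cong refl) (auto simp: prefix_state_eq norm_divide power_divide subset_iff)
    also have "\<dots> = real (card {x \<in> bitstrings n. take (2 * j) x = take (2 * j) (f u)}) / 2 ^ (n - 2 * j)"
      by (simp add: sum.If_cases Int_def)
    \<comment> \<open>The count is over \<open>x\<close> itself, so the preimage count is used with
      the identity in place of \<open>f\<close>.\<close>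
    also have "\<dots> = 1"
      using card_prefix_preimage[of "\<lambda>x. x" n "f u" "2 * j"] fu assms(3) by (simp add: bij_betw_def)
    finally show ?thesis .
  qed
  then have "(\<Sum>x\<in>bitstrings n. \<Sum>u\<in>X. (cmod (prefix_state f n j x u))\<^sup>2) = real (card X)"
    by (subst sum.swap) simp
  then show ?thesis
    by (simp add: step_error_def sum.distrib card_bitstrings flip: sum_distrib_left)
qed

text \<open>The sign flip leaves the moduli of all amplitudes unchanged, so the state fed to the
  reflection has the same weight on \<open>X\<close> as the prefix state before it. The second
  square root comes from the state after the reflection.\<close>

lemma iteration_deviation:
  assumes f: "bij_betw f (bitstrings n) (bitstrings n)" and j: "j < n div 2"
    and J: "op_unitary (n + a) J" and X: "X \<subseteq> bitstrings n" and "0 \<le> \<alpha>"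
    and close: "\<And>z. z \<in> bitstrings n - X \<Longrightarrow> cmod (1 - J (z @ zeros a) (z @ zeros a)) \<le> \<alpha>"
    and T: "op_isometry (n + (n + a)) (conj_reflection_op f n (n + a) J j)"
    and x: "x \<in> bitstrings n"
  shows "qnorm (n + (n + a)) (\<lambda>z. op_app (n + (n + a)) (conj_reflection_op f n (n + a) J j)
      (op_app (n + (n + a)) (phase_oracle f n j) (reg_state n a x (prefix_state f n j x))) z
      - reg_state n a x (prefix_state f n (Suc j) x) z)
    \<le> sqrt (step_error f n X \<alpha> j x) + sqrt (step_error f n X \<alpha> (Suc j) x)"
proof -
  let ?N = "n + (n + a)" and ?G = "op_adj (op_tensor n op_id J)"
  let ?s = "\<lambda>u. match_sign j x (f u) * prefix_state f n j x u"
  let ?T = "conj_reflection_op f n (n + a) J j"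
  let ?u = "reg_state n a x ?s" and ?v = "reg_state n a x (prefix_state f n (Suc j) x)"
  have "op_app ?N ?T (op_app ?N (phase_oracle f n j) (reg_state n a x (prefix_state f n j x)))
      = op_app ?N ?T ?u"
    by (rule op_app_cong) (rule op_app_phase_oracle[OF _ x])
  moreover have "qnorm ?N (\<lambda>z. op_app ?N ?T ?u z - ?v z)
      \<le> qnorm ?N (\<lambda>z. op_app ?N ?G ?u z - ?u z) + qnorm ?N (\<lambda>z. op_app ?N ?G ?v z - ?v z)"
  proof (rule conj_reflection_deviation[OF J T])
    fix z assume z: "z \<in> bitstrings ?N"
    have "take n (drop n z) \<in> bitstrings n" using z by (simp add: bitstrings_def)
    from grover_step[OF f x j this]
    show "op_app ?N (op_tensor (2 * n) (reflection_op f n j) op_id) ?u z = ?v z"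
      unfolding op_app_reflection[OF z x] by (simp add: reg_state_def)
  qed
  moreover have "qnorm ?N (\<lambda>z. op_app ?N ?G ?u z - ?u z) \<le> sqrt (step_error f n X \<alpha> j x)"
  proof (rule real_le_rsqrt)
    have "(\<Sum>u\<in>X. (cmod (?s u))\<^sup>2) = (\<Sum>u\<in>X. (cmod (prefix_state f n j x u))\<^sup>2)"
      by (simp add: norm_mult)
    then show "(qnorm ?N (\<lambda>z. op_app ?N ?G ?u z - ?u z))\<^sup>2 \<le> step_error f n X \<alpha> j x"
      using pseudo_identity_deviation[OF J X \<open>0 \<le> \<alpha>\<close> close x, of ?s] cmod_prefix_state_le
      by (simp add: step_error_def norm_mult)
  qed
  moreover have "qnorm ?N (\<lambda>z. op_app ?N ?G ?v z - ?v z) \<le> sqrt (step_error f n X \<alpha> (Suc j) x)"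
    unfolding step_error_def
    by (rule real_le_rsqrt, rule pseudo_identity_deviation[OF J X \<open>0 \<le> \<alpha>\<close> close x])
       (auto intro: cmod_prefix_state_le)
  ultimately show ?thesis by simp
qed

text \<open>With \<open>j = 0\<close> the prefix is empty, and the prefix state is the uniform
  superposition for every \<open>f\<close> and \<open>x\<close>.\<close>

lemma hadamard_circuit_ket:
  assumes "x \<in> bitstrings n" "z \<in> bitstrings (n + (n + a))"
  shows "circuit_op (n + (n + a)) (hadamard_circuit n n) z (x @ zeros (n + a))
    = reg_state n a x (prefix_state f n 0 x) z"
proof -
  let ?N = "n + (n + a)"
  obtain y u w where z: "z = y @ u @ w" "y \<in> bitstrings n" "u \<in> bitstrings n" "w \<in> bitstrings a"
    using assms(2) by (rule bitstrings_registersE)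
  have len: "length x = n" "length y = n" "length u = n" "length w = a"
    using assms z by (simp_all add: bitstrings_def)
  have "(\<forall>i<?N. i \<notin> {n..<n + n} \<longrightarrow> z ! i = (x @ zeros (n + a)) ! i) \<longleftrightarrow> y = x \<and> w = zeros a"
  proof (intro iffI conjI)
    assume L: "\<forall>i<?N. i \<notin> {n..<n + n} \<longrightarrow> z ! i = (x @ zeros (n + a)) ! i"
    show "y = x"
    proof (rule nth_equalityI)
      fix i assume "i < length y"
      then show "y ! i = x ! i" using L[rule_format, of i] len by (simp add: z(1) nth_append)
    qed (simp add: len)
    show "w = zeros a"
    proof (rule nth_equalityI)
      fix i assume "i < length w"
      then show "w ! i = zeros a ! i"
        using L[rule_format, of "n + n + i"] len by (simp add: z(1) nth_append del: replicate_add)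
    qed (simp add: len)
  next
    assume "y = x \<and> w = zeros a"
    then show "\<forall>i<?N. i \<notin> {n..<n + n} \<longrightarrow> z ! i = (x @ zeros (n + a)) ! i"
      using len by (auto simp: z(1) nth_append)
  qed
  moreover have "circuit_op ?N (hadamard_circuit n n) z (x @ zeros (n + a))
    = of_bool (\<forall>i<?N. i \<notin> {n..<n + n} \<longrightarrow> z ! i = (x @ zeros (n + a)) ! i) / complex_of_real (sqrt 2) ^ n"
    using assms by (intro circuit_op_hadamard_circuit) (auto simp: bitstrings_def nth_append)
  ultimately show ?thesis
    using z(2-) by (simp add: z(1) reg_state_append prefix_state_eq real_sqrt_power of_bool_conj)
qed

text \<open>Every iteration is an isometry, so earlier deviations are carried along without growth
  and the errors of the iterations add up. The circuit is chosen before \<open>x\<close>, as one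
  circuit has to serve all inputs.\<close>

lemma inversion_run:
  assumes f: "bij_betw f (bitstrings n) (bitstrings n)"
    and J: "op_unitary (n + a) J" and X: "X \<subseteq> bitstrings n" and "0 \<le> \<alpha>"
    and close: "\<And>z. z \<in> bitstrings n - X \<Longrightarrow> cmod (1 - J (z @ zeros a) (z @ zeros a)) \<le> \<alpha>"
    and phase: "\<And>j. j < n div 2 \<Longrightarrow> \<exists>D. implements (n + (n + a)) D (phase_oracle f n j) \<and> length D \<le> L"
    and conj_refl: "\<And>j. j < n div 2 \<Longrightarrow>
      \<exists>D. implements (n + (n + a)) D (conj_reflection_op f n (n + a) J j) \<and> length D \<le> S"
    and "h \<le> n div 2"
  shows "\<exists>C V. implements (n + (n + a)) C V \<and> length C \<le> n + h * (L + S) \<and>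
    (\<forall>x\<in>bitstrings n. qnorm (n + (n + a)) (\<lambda>z. op_app (n + (n + a)) V (ket (x @ zeros (n + a))) z
        - reg_state n a x (prefix_state f n h x) z)
      \<le> (\<Sum>i<h. sqrt (step_error f n X \<alpha> i x) + sqrt (step_error f n X \<alpha> (Suc i) x)))"
  using \<open>h \<le> n div 2\<close>
proof (induction h)
  case 0
  let ?N = "n + (n + a)" and ?C = "hadamard_circuit n n"
  have "implements ?N ?C (circuit_op ?N ?C)"
    by (intro implements_circuit valid_hadamard_circuit) simp
  moreover have "length ?C \<le> n" by (simp add: hadamard_circuit_def)
  moreover have "qnorm ?N (\<lambda>z. op_app ?N (circuit_op ?N ?C) (ket (x @ zeros (n + a))) z
        - reg_state n a x (prefix_state f n 0 x) z) \<le> 0" if x: "x \<in> bitstrings n" for x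
  proof -
    have "qnorm ?N (\<lambda>z. op_app ?N (circuit_op ?N ?C) (ket (x @ zeros (n + a))) z
        - reg_state n a x (prefix_state f n 0 x) z) = qnorm ?N (\<lambda>z. 0)"
      using x by (intro qnorm_cong) (simp add: op_app_ket hadamard_circuit_ket[where f = f])
    then show ?thesis by (simp add: qnorm_def L2_set_def)
  qed
  ultimately show ?case by fastforce
next
  case (Suc h)
  let ?N = "n + (n + a)"
  let ?S = "phase_oracle f n h" and ?T = "conj_reflection_op f n (n + a) J h"
  let ?e = "\<lambda>h x. \<Sum>i<h. sqrt (step_error f n X \<alpha> i x) + sqrt (step_error f n X \<alpha> (Suc i) x)"
  have h: "h < n div 2" using Suc.prems by simp
  obtain C V where C: "implements ?N C V" "length C \<le> n + h * (L + S)"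
    and V: "\<And>x. x \<in> bitstrings n \<Longrightarrow> qnorm ?N (\<lambda>z. op_app ?N V (ket (x @ zeros (n + a))) z
        - reg_state n a x (prefix_state f n h x) z) \<le> ?e h x"
    using Suc.IH h by auto
  obtain D1 where D1: "implements ?N D1 ?S" "length D1 \<le> L" using phase[OF h] by blast
  obtain D2 where D2: "implements ?N D2 ?T" "length D2 \<le> S" using conj_refl[OF h] by blast
  let ?W = "op_mult ?N (op_mult ?N ?T ?S) V"
  have "implements ?N (C @ D1 @ D2) ?W"
    by (intro implements_append C D1 D2)
  moreover have "length (C @ D1 @ D2) \<le> n + Suc h * (L + S)" using C(2) D1(2) D2(2) by simp
  moreover have "qnorm ?N (\<lambda>z. op_app ?N ?W (ket (x @ zeros (n + a))) z
        - reg_state n a x (prefix_state f n (Suc h) x) z) \<le> ?e (Suc h) x"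
    if x: "x \<in> bitstrings n" for x
  proof -
    let ?\<phi> = "reg_state n a x (prefix_state f n h x)"
    let ?v = "op_app ?N V (ket (x @ zeros (n + a)))"
    have iso: "op_isometry ?N (op_mult ?N ?T ?S)"
      using D1(1) D2(1) by (intro op_isometry_mult implements_isometry)
    have "qnorm ?N (\<lambda>z. op_app ?N ?W (ket (x @ zeros (n + a))) z - op_app ?N (op_mult ?N ?T ?S) ?\<phi> z)
        = qnorm ?N (\<lambda>z. ?v z - ?\<phi> z)"
      using qnorm_op_app[OF iso, of "\<lambda>z. ?v z - ?\<phi> z"] by (simp add: op_app_diff op_app_mult)
    moreover have "qnorm ?N (\<lambda>z. op_app ?N (op_mult ?N ?T ?S) ?\<phi> z
        - reg_state n a x (prefix_state f n (Suc h) x) z)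
      \<le> sqrt (step_error f n X \<alpha> h x) + sqrt (step_error f n X \<alpha> (Suc h) x)"
      using iteration_deviation[OF f h J X \<open>0 \<le> \<alpha>\<close> close implements_isometry[OF D2(1)] x]
      by (simp add: op_app_mult)
    ultimately show ?thesis
      using V[OF x] qnorm_triangle[of ?N "op_app ?N ?W (ket (x @ zeros (n + a)))"
          "reg_state n a x (prefix_state f n (Suc h) x)" "op_app ?N (op_mult ?N ?T ?S) ?\<phi>"]
      by simp
  qed
  ultimately show ?case by blast
qed

text \<open>The circuit runs on \<open>f x\<close>. An output \<open>y \<noteq> x\<close> has
  amplitude zero in the target state, so the failure probability is at most the squared distance of
  the final state from the target; this is then summed over \<open>x\<close>.\<close>

lemma inversion_circuit:
  assumes f: "bij_betw f (bitstrings n) (bitstrings n)" and "even n"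
    and J: "op_unitary (n + a) J" and X: "X \<subseteq> bitstrings n" and "0 \<le> \<alpha>"
    and close: "\<And>z. z \<in> bitstrings n - X \<Longrightarrow> cmod (1 - J (z @ zeros a) (z @ zeros a)) \<le> \<alpha>"
    and phase: "\<And>j. j < n div 2 \<Longrightarrow> \<exists>D. implements (n + (n + a)) D (phase_oracle f n j) \<and> length D \<le> L"
    and conj_refl: "\<And>j. j < n div 2 \<Longrightarrow>
      \<exists>D. implements (n + (n + a)) D (conj_reflection_op f n (n + a) J j) \<and> length D \<le> S"
  obtains m C where "valid_circuit (n + m) C" "length C \<le> 2 * n + n * (L + S)"
    "(\<Sum>x\<in>bitstrings n. \<Sum>y\<in>bitstrings n - {x}. \<Sum>w\<in>bitstrings m.
        (cmod (circuit_op (n + m) C (y @ w) (f x @ zeros m)))\<^sup>2)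
      \<le> (real n)\<^sup>2 * (2 ^ n * (4 * \<alpha> * 4 ^ n) + 8 * real (card X))"
proof -
  let ?N = "n + (n + a)"
  define h where "h = n div 2"
  have n: "n = 2 * h" using \<open>even n\<close> by (simp add: h_def)
  define err where "err i x = step_error f n X \<alpha> i x" for i x
  define K where "K = 2 ^ n * (4 * \<alpha> * 4 ^ n) + 8 * real (card X)"
  have err0: "0 \<le> err i x" for i x using \<open>0 \<le> \<alpha>\<close> by (simp add: err_def step_error_nonneg)
  obtain C V where C: "implements ?N C V" "length C \<le> n + h * (L + S)"
    and V: "\<And>x. x \<in> bitstrings n \<Longrightarrow> qnorm ?N (\<lambda>z. op_app ?N V (ket (x @ zeros (n + a))) z
        - reg_state n a x (prefix_state f n h x) z) \<le> (\<Sum>i<h. sqrt (err i x) + sqrt (err (Suc i) x))"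
    using inversion_run[OF f J X \<open>0 \<le> \<alpha>\<close> close phase conj_refl order_refl]
    unfolding h_def err_def by blast
  define SW where "SW = circuit_op ?N (swap_circuit n)"
  define W where "W = op_mult ?N SW V"
  have swap: "SW z (x @ y @ w) = of_bool (z = y @ x @ w)"
    if "z \<in> bitstrings ?N" "x \<in> bitstrings n" "y \<in> bitstrings n" "w \<in> bitstrings a" for x y w z
    using circuit_op_swap_circuit(2)[of x n y w a z] that by (simp add: SW_def add.assoc)
  have "valid_circuit ?N (swap_circuit n)"
    using circuit_op_swap_circuit(1)[of "zeros n" n "zeros n" "zeros a" a "zeros (n + n + a)"]
    by (simp only: zeros_in_bitstrings add.assoc)
  then have imp_swap: "implements ?N (swap_circuit n) SW"
    unfolding SW_def by (rule implements_circuit)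
  have imp: "implements ?N (C @ swap_circuit n) W"
    unfolding W_def by (rule implements_append[OF C(1) imp_swap])
  obtain m where v: "valid_circuit (?N + m) (C @ swap_circuit n)"
    and c: "\<And>x u w. x \<in> bitstrings ?N \<Longrightarrow> u \<in> bitstrings ?N \<Longrightarrow> w \<in> bitstrings m \<Longrightarrow>
        circuit_op (?N + m) (C @ swap_circuit n) (u @ w) (x @ zeros m) = W u x * of_bool (w = zeros m)"
    by (rule implementsE[OF imp]) blast
  \<comment> \<open>In \<open>output_prob\<close> every wire except the first \<open>n\<close> is a
    work qubit: the second register, the \<open>a\<close> ancillas and the \<open>m\<close> work
    qubits of the implementation.\<close>
  define M where "M = n + a + m"
  have M: "n + M = ?N + m" by (simp add: M_def)
  define fail where "fail x = (\<Sum>y\<in>bitstrings n - {x}. \<Sum>w\<in>bitstrings M.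
        (cmod (circuit_op (n + M) (C @ swap_circuit n) (y @ w) (f x @ zeros M)))\<^sup>2)" for x
  have fail: "fail x \<le> real h * (\<Sum>i<h. 2 * err i (f x) + 2 * err (Suc i) (f x))"
    if x: "x \<in> bitstrings n" for x
  proof -
    define b where "b = f x"
    have b: "b \<in> bitstrings n" using f x by (auto simp: b_def bij_betw_def)
    let ?k = "b @ zeros (n + a)"
    \<comment> \<open>The ideal final state after the swap: preimage in front, input behind it,
      ancillas zero.\<close>
    let ?\<tau> = "x @ b @ zeros a"
    have k: "?k \<in> bitstrings ?N" using b by (simp del: replicate_add)
    have \<tau>: "?\<tau> \<in> bitstrings ?N" using b x by simp
    \<comment> \<open>Since \<open>2 * h = n\<close>, the prefix is the whole string, and
      injectivity of \<open>f\<close> leaves \<open>x\<close> alone.\<close>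
    have fin: "reg_state n a b (prefix_state f n h b) z = ket (b @ x @ zeros a) z"
      if mem: "z \<in> bitstrings ?N" for z
    proof -
      obtain y u w where z: "z = y @ u @ w" "y \<in> bitstrings n" "u \<in> bitstrings n" "w \<in> bitstrings a"
        using mem by (rule bitstrings_registersE)
      have "f u \<in> bitstrings n" using f z by (auto simp: bij_betw_def)
      then have "take n (f u) = take n b \<longleftrightarrow> u = x"
        using f x z(3) b by (auto simp: b_def bitstrings_def bij_betw_def inj_on_def)
      then show ?thesis
        using z(2-) x b by (auto simp: z(1) reg_state_append prefix_state_eq n[symmetric] ket_def bitstrings_def)
    qed
    have "fail x = (\<Sum>y\<in>bitstrings n - {x}. \<Sum>w1\<in>bitstrings (n + a). \<Sum>w2\<in>bitstrings m.
        (cmod (circuit_op (?N + m) (C @ swap_circuit n) ((y @ w1) @ w2) (?k @ zeros m)))\<^sup>2)"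
      unfolding fail_def M unfolding M_def sum_bitstrings_add
      by (simp only: b_def replicate_add append_assoc)
    also have "\<dots> = (\<Sum>y\<in>bitstrings n - {x}. \<Sum>w1\<in>bitstrings (n + a). (cmod (W (y @ w1) ?k))\<^sup>2)"
    proof (intro sum.cong refl)
      fix y w1 assume "y \<in> bitstrings n - {x}" "w1 \<in> bitstrings (n + a)"
      then have yw: "y @ w1 \<in> bitstrings ?N" by simp
      have "(\<Sum>w2\<in>bitstrings m. (cmod (circuit_op (?N + m) (C @ swap_circuit n) ((y @ w1) @ w2) (?k @ zeros m)))\<^sup>2)
          = (\<Sum>w2\<in>bitstrings m. if w2 = zeros m then (cmod (W (y @ w1) ?k))\<^sup>2 else 0)"
        by (intro sum.cong refl) (simp add: c[OF k yw] del: append_assoc replicate_add)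
      then show "(\<Sum>w2\<in>bitstrings m. (cmod (circuit_op (?N + m) (C @ swap_circuit n) ((y @ w1) @ w2) (?k @ zeros m)))\<^sup>2)
          = (cmod (W (y @ w1) ?k))\<^sup>2" by simp
    qed
    also have "\<dots> = (\<Sum>y\<in>bitstrings n - {x}. \<Sum>w1\<in>bitstrings (n + a).
        (cmod (op_app ?N W (ket ?k) (y @ w1) - ket ?\<tau> (y @ w1)))\<^sup>2)"
    proof (intro sum.cong refl)
      fix y w1 assume y: "y \<in> bitstrings n - {x}" and w1: "w1 \<in> bitstrings (n + a)"
      then have "ket ?\<tau> (y @ w1) = 0" using x by (auto simp: ket_def bitstrings_def)
      then show "(cmod (W (y @ w1) ?k))\<^sup>2 = (cmod (op_app ?N W (ket ?k) (y @ w1) - ket ?\<tau> (y @ w1)))\<^sup>2"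
        by (simp only: op_app_ket[OF k] diff_zero)
    qed
    also have "\<dots> \<le> (\<Sum>y\<in>bitstrings n. \<Sum>w1\<in>bitstrings (n + a).
        (cmod (op_app ?N W (ket ?k) (y @ w1) - ket ?\<tau> (y @ w1)))\<^sup>2)"
      by (intro sum_mono2) (auto intro: sum_nonneg)
    also have "\<dots> = (qnorm ?N (\<lambda>z. op_app ?N W (ket ?k) z - ket ?\<tau> z))\<^sup>2"
      by (simp only: qnorm_power2 sum_bitstrings_add)
    also have "qnorm ?N (\<lambda>z. op_app ?N W (ket ?k) z - ket ?\<tau> z)
        = qnorm ?N (op_app ?N SW (\<lambda>z. op_app ?N V (ket ?k) z - reg_state n a b (prefix_state f n h b) z))"
    proof (rule qnorm_cong)
      fix z assume z: "z \<in> bitstrings ?N"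
      have bx: "b @ x @ zeros a \<in> bitstrings ?N" using b x by simp
      have "op_app ?N SW (reg_state n a b (prefix_state f n h b)) = op_app ?N SW (ket (b @ x @ zeros a))"
        by (rule op_app_cong) (rule fin)
      then have "op_app ?N SW (reg_state n a b (prefix_state f n h b)) z = ket ?\<tau> z"
        using swap[OF z b x zeros_in_bitstrings] by (simp only: op_app_ket[OF bx]) (auto simp: ket_def)
      then show "op_app ?N W (ket ?k) z - ket ?\<tau> z
          = op_app ?N SW (\<lambda>z. op_app ?N V (ket ?k) z - reg_state n a b (prefix_state f n h b) z) z"
        by (simp only: op_app_diff W_def op_app_mult)
    qed
    also have "\<dots> = qnorm ?N (\<lambda>z. op_app ?N V (ket ?k) z - reg_state n a b (prefix_state f n h b) z)"
      by (rule qnorm_op_app[OF implements_isometry[OF imp_swap]])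
    also have "(\<dots>)\<^sup>2 \<le> (\<Sum>i<h. sqrt (err i b) + sqrt (err (Suc i) b))\<^sup>2"
      by (intro power_mono V[OF b]) simp
    \<comment> \<open>Moving the square inside makes the bound linear in the errors, whose sum over
      all inputs is known.\<close>
    also have "\<dots> \<le> (\<Sum>i<h. (sqrt (err i b) + sqrt (err (Suc i) b))\<^sup>2) * real (card {..<h})"
      by (rule sum_squared_le_sum_of_squares)
    also have "\<dots> \<le> (\<Sum>i<h. 2 * err i b + 2 * err (Suc i) b) * real h"
    proof (simp only: card_lessThan, intro mult_right_mono sum_mono)
      fix i
      show "(sqrt (err i b) + sqrt (err (Suc i) b))\<^sup>2 \<le> 2 * err i b + 2 * err (Suc i) b"
        using sum_power2_le[of "sqrt (err i b)" "sqrt (err (Suc i) b)"] err0 by simp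
    qed simp
    finally show ?thesis by (simp only: b_def mult.commute)
  qed
  have err_sum: "(\<Sum>x\<in>bitstrings n. err i (f x)) = K" if "2 * i \<le> n" for i
  proof -
    have "(\<Sum>x\<in>bitstrings n. err i (f x)) = (\<Sum>x\<in>bitstrings n. err i x)"
      by (rule sum.reindex_bij_betw[OF f])
    then show ?thesis unfolding err_def K_def using sum_step_error[OF f X that] by simp
  qed
  have "(\<Sum>x\<in>bitstrings n. fail x)
      \<le> (\<Sum>x\<in>bitstrings n. real h * (\<Sum>i<h. 2 * err i (f x) + 2 * err (Suc i) (f x)))"
    by (rule sum_mono) (rule fail)
  also have "\<dots> = real h * (\<Sum>i<h. \<Sum>x\<in>bitstrings n. 2 * err i (f x) + 2 * err (Suc i) (f x))"
    by (subst sum.swap) (simp only: sum_distrib_left)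
  \<comment> \<open>Each of the two neighbouring errors sums to \<open>K\<close> over the inputs,
    giving \<open>2 * K + 2 * K\<close>; since \<open>n = 2 * h\<close>, the factor
    \<open>4 * h * h\<close> then becomes \<open>n\<^sup>2\<close>.\<close>
  also have "\<dots> = real h * (\<Sum>i<h. 4 * K)"
  proof -
    have "(\<Sum>x\<in>bitstrings n. 2 * err i (f x) + 2 * err (Suc i) (f x)) = 4 * K" if "i < h" for i
      using that err_sum[of i] err_sum[of "Suc i"] n by (simp add: sum.distrib flip: sum_distrib_left)
    then show ?thesis by simp
  qed
  also have "\<dots> = (real n)\<^sup>2 * K" by (simp add: n power2_eq_square)
  finally have fail_sum: "(\<Sum>x\<in>bitstrings n. fail x) \<le> (real n)\<^sup>2 * K" .
  have valid: "valid_circuit (n + M) (C @ swap_circuit n)" using v by (simp only: M)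
  have size: "length (C @ swap_circuit n) \<le> 2 * n + n * (L + S)"
  proof -
    have "h * (L + S) \<le> n * (L + S)" by (intro mult_right_mono) (auto simp: n)
    moreover have "length (C @ swap_circuit n) = length C + n" by (simp add: swap_circuit_def)
    ultimately show ?thesis using C(2) by linarith
  qed
  show ?thesis by (rule that[OF valid size fail_sum[unfolded fail_def K_def]])
qed


section \<open>Polynomial bounds\<close>

lemma pos_polynomial_const: "0 < c \<Longrightarrow> pos_polynomial (\<lambda>n. c)"
  unfolding pos_polynomial_def by (intro exI[of _ "[:real c:]"]) simp

lemma pos_polynomial_id: "pos_polynomial (\<lambda>n. n)"
  unfolding pos_polynomial_def by (intro exI[of _ "[:0, 1:]"]) simp

lemma pos_polynomial_add:
  assumes "pos_polynomial p" "pos_polynomial q"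
  shows "pos_polynomial (\<lambda>n. p n + q n)"
proof -
  obtain P Q where "\<forall>n\<ge>1. 0 < p n \<and> real (p n) = poly P (real n)"
    "\<forall>n\<ge>1. 0 < q n \<and> real (q n) = poly Q (real n)"
    using assms unfolding pos_polynomial_def by blast
  then show ?thesis unfolding pos_polynomial_def by (intro exI[of _ "P + Q"]) simp
qed

lemma pos_polynomial_mult:
  assumes "pos_polynomial p" "pos_polynomial q"
  shows "pos_polynomial (\<lambda>n. p n * q n)"
proof -
  obtain P Q where "\<forall>n\<ge>1. 0 < p n \<and> real (p n) = poly P (real n)"
    "\<forall>n\<ge>1. 0 < q n \<and> real (q n) = poly Q (real n)"
    using assms unfolding pos_polynomial_def by blast
  then show ?thesis unfolding pos_polynomial_def by (intro exI[of _ "P * Q"]) simp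
qed

text \<open>\<open>p\<close> is made so that \<open>2 ^ p = 4 * 4 ^ n * 2 ^ k\<close> with
  \<open>k = 16 * n * n * q\<close>; the first term is then \<open>n * n / 2 ^ k\<close>, at most
  \<open>n * n / k = 1 / (16 * q)\<close>. As \<open>p \<ge> k\<close>, the second is at most
  \<open>8 * n * n / k = 1 / (2 * q)\<close>, and the sum stays below \<open>1 / q\<close>.\<close>

lemma error_parameters:
  fixes n q p :: nat and X \<alpha> :: real
  assumes "0 < n" "0 < q" and p: "p = 2 * n + 2 + 16 * n * n * q"
    and X: "X / 2 ^ n \<le> 1 / real p"
  shows "(real n)\<^sup>2 * (2 ^ n * (4 * (1 / 2 ^ p) * 4 ^ n) + 8 * X) / 2 ^ n \<le> 1 / real q"
proof -
  define k where "k = 16 * n * n * q"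
  have k: "0 < k" using assms by (simp add: k_def)
  have rk: "real k = 16 * (real n)\<^sup>2 * real q" by (simp add: k_def power2_eq_square)
  have n2: "0 < (real n)\<^sup>2" using assms by simp
  have "(2 :: real) ^ p = 4 * 4 ^ n * 2 ^ k"
    by (simp add: p k_def power_add power_mult)
  then have "4 * (1 / 2 ^ p) * 4 ^ n = 1 / (2 :: real) ^ k" by simp
  also have "\<dots> \<le> 1 / real k"
    using k by (intro divide_left_mono) (auto simp: less_imp_le[OF of_nat_less_two_power])
  finally have "(real n)\<^sup>2 * (4 * (1 / 2 ^ p) * 4 ^ n) \<le> (real n)\<^sup>2 * (1 / real k)"
    by (intro mult_left_mono) auto
  also have "\<dots> = 1 / (16 * real q)" using n2 by (simp add: rk)
  finally have 1: "(real n)\<^sup>2 * (4 * (1 / 2 ^ p) * 4 ^ n) \<le> 1 / (16 * real q)" .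
  have "k \<le> p" by (simp add: p k_def)
  then have "1 / real p \<le> 1 / real k" using k by (intro divide_left_mono) auto
  with X have "(real n)\<^sup>2 * (8 * (X / 2 ^ n)) \<le> (real n)\<^sup>2 * (8 * (1 / real k))"
    by (intro mult_left_mono) auto
  also have "\<dots> = 1 / (2 * real q)" using n2 by (simp add: rk)
  finally have 2: "(real n)\<^sup>2 * (8 * (X / 2 ^ n)) \<le> 1 / (2 * real q)" .
  have "(real n)\<^sup>2 * (2 ^ n * (4 * (1 / 2 ^ p) * 4 ^ n) + 8 * X) / 2 ^ n
      = (real n)\<^sup>2 * (4 * (1 / 2 ^ p) * 4 ^ n) + (real n)\<^sup>2 * (8 * (X / 2 ^ n))"
    by (simp add: field_simps)
  also have "\<dots> \<le> 1 / (16 * real q) + 1 / (2 * real q)" using 1 2 by (rule add_mono)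
  also have "\<dots> \<le> 1 / real q" using assms by (simp add: field_simps)
  finally show ?thesis .
qed

section \<open>The inverting circuit family against the one-wayness bound\<close>

theorem theorem3p2:
  fixes f :: "bool list \<Rightarrow> bool list"
  assumes "length_preserving_permutation f"
    and "poly_size_computable f"
    and "\<And>p. pos_polynomial p \<Longrightarrow>
      \<exists>r s. pos_polynomial r \<and> (\<forall>n. n \<le> r n) \<and> pos_polynomial s \<and>
        (\<exists>\<^sub>\<infinity>n. even n \<and>
          (\<exists>J. pseudo_identity n (r n) (1 / 2 ^ p n) (1 / real (p n)) J \<and>
            (\<forall>j<n div 2. \<exists>C. implements (n + r n) C (conj_reflection_op f n (r n) J j) \<and>
              length C \<le> s n)))"
  shows "\<not> weakly_quantum_one_way f"
proof
  assume "weakly_quantum_one_way f"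
  then obtain q where q: "pos_polynomial q"
    and hard: "\<And>A. poly_size_family A \<Longrightarrow>
      (\<forall>\<^sub>F n in sequentially. inversion_failure_prob A f n > 1 / real (q n))"
    unfolding weakly_quantum_one_way_def by blast
  have f: "bij_betw f (bitstrings n) (bitstrings n)" for n
    using assms(1) by (simp add: length_preserving_permutation_def)
  obtain F l where l: "pos_polynomial l"
    and F: "\<And>n. valid_circuit (n + fst (F n)) (snd (F n))" "\<And>n. length (snd (F n)) \<le> l n"
    and F_prob: "\<And>n x. x \<in> bitstrings n \<Longrightarrow> output_prob F n x (f x) = 1"
    using assms(2) unfolding poly_size_computable_def poly_size_family_def by blast
  \<comment> \<open>The polynomial fed to the hypothesis depends on the alleged one-wayness bound
    \<open>q\<close>; its form is that of \<open>error_parameters\<close>.\<close>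
  define p where "p n = 2 * n + 2 + 16 * n * n * q n" for n
  have "pos_polynomial p"
    unfolding p_def by (intro pos_polynomial_add pos_polynomial_mult pos_polynomial_const
        pos_polynomial_id q) simp_all
  then obtain r s where r: "\<And>n. n \<le> r n" and s: "pos_polynomial s"
    and many: "\<exists>\<^sub>\<infinity>n. even n \<and>
          (\<exists>J. pseudo_identity n (r n) (1 / 2 ^ p n) (1 / real (p n)) J \<and>
            (\<forall>j<n div 2. \<exists>C. implements (n + r n) C (conj_reflection_op f n (r n) J j) \<and>
              length C \<le> s n))"
    using assms(3) by blast
  define good where "good n \<longleftrightarrow> even n \<and>
    (\<exists>J. pseudo_identity n (r n) (1 / 2 ^ p n) (1 / real (p n)) J \<and>
      (\<forall>j<n div 2. \<exists>C. implements (n + r n) C (conj_reflection_op f n (r n) J j) \<and>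
        length C \<le> s n))" for n
  \<comment> \<open>Hadamard gates and swaps take \<open>2 * n\<close> gates; each of at most
    \<open>n\<close> iterations takes two runs of the circuit for \<open>f\<close>, the five gates
    of the comparison, and one conjugated reflection.\<close>
  define t where "t n = 2 * n + n * (2 * l n + 5 + s n)" for n
  have t: "pos_polynomial t"
    unfolding t_def by (intro pos_polynomial_add pos_polynomial_mult pos_polynomial_const
        pos_polynomial_id l s) simp_all
  define ok where "ok n mC \<longleftrightarrow> valid_circuit (n + fst mC) (snd mC) \<and> length (snd mC) \<le> t n \<and>
    (\<Sum>x\<in>bitstrings n. \<Sum>y\<in>bitstrings n - {x}. \<Sum>w\<in>bitstrings (fst mC).
        (cmod (circuit_op (n + fst mC) (snd mC) (y @ w) (f x @ zeros (fst mC))))\<^sup>2) / 2 ^ n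
      \<le> 1 / real (q n)" for n and mC :: "nat \<times> gate list"
  have ex_ok: "\<exists>mC. ok n mC" if "0 < n" "good n" for n
  proof -
    obtain J where J: "pseudo_identity n (r n) (1 / 2 ^ p n) (1 / real (p n)) J"
      and cr: "\<And>j. j < n div 2 \<Longrightarrow>
        \<exists>C. implements (n + r n) C (conj_reflection_op f n (r n) J j) \<and> length C \<le> s n"
      using \<open>good n\<close> unfolding good_def by blast
    obtain a where a: "r n = n + a" using r le_Suc_ex by blast
    obtain X where U: "op_unitary (n + a) J" and X: "X \<subseteq> bitstrings n"
      "real (card X) / 2 ^ n \<le> 1 / real (p n)"
      and close: "\<And>z. z \<in> bitstrings n - X \<Longrightarrow>
        cmod (1 - J (z @ zeros a) (z @ zeros a)) \<le> 1 / 2 ^ p n"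
      using J unfolding pseudo_identity_def a by auto
    have prob: "(\<Sum>w\<in>bitstrings (fst (F n)).
        (cmod (circuit_op (n + fst (F n)) (snd (F n)) (f x @ w) (x @ zeros (fst (F n)))))\<^sup>2) = 1"
      if "x \<in> bitstrings n" for x
      using F_prob[OF that] by (simp add: output_prob_def case_prod_unfold)
    have phase: "\<exists>D. implements (n + (n + a)) D (phase_oracle f n j) \<and> length D \<le> 2 * l n + 5"
      if j: "j < n div 2" for j
      using implements_phase_oracle[OF F(1) _ prob j, of "n + a"] F(2)[of n] bij_betwE[OF f[of n]]
      by fastforce
    have "even n" using \<open>good n\<close> by (simp add: good_def)
    have cr': "\<exists>D. implements (n + (n + a)) D (conj_reflection_op f n (n + a) J j) \<and> length D \<le> s n"
      if "j < n div 2" for j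
      using cr[OF that] unfolding a .
    have nonneg: "0 \<le> 1 / (2 :: real) ^ p n" by simp
    obtain m C where "valid_circuit (n + m) C" "length C \<le> 2 * n + n * (2 * l n + 5 + s n)"
      and le: "(\<Sum>x\<in>bitstrings n. \<Sum>y\<in>bitstrings n - {x}. \<Sum>w\<in>bitstrings m.
        (cmod (circuit_op (n + m) C (y @ w) (f x @ zeros m)))\<^sup>2)
      \<le> (real n)\<^sup>2 * (2 ^ n * (4 * (1 / 2 ^ p n) * 4 ^ n) + 8 * real (card X))" (is "?fail \<le> ?bound")
      by (rule inversion_circuit[OF f \<open>even n\<close> U X(1) nonneg close phase cr'])
    moreover have "?fail / 2 ^ n \<le> 1 / real (q n)"
    proof -
      have "0 < q n" using q \<open>0 < n\<close> by (auto simp: pos_polynomial_def)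
      have "?fail / 2 ^ n \<le> ?bound / 2 ^ n" using le by (rule divide_right_mono) simp
      also have "\<dots> \<le> 1 / real (q n)"
        by (rule error_parameters[OF \<open>0 < n\<close> \<open>0 < q n\<close> p_def X(2)])
      finally show ?thesis .
    qed
    ultimately have "ok n (m, C)" by (simp add: ok_def t_def)
    then show ?thesis by blast
  qed
  \<comment> \<open>At all other lengths the empty circuit keeps the family valid and small. Length
    0 is excluded because \<open>pos_polynomial\<close> says nothing about the value of
    \<open>q\<close> there.\<close>
  define A where "A n = (if 0 < n \<and> good n then SOME mC. ok n mC else (0, []))" for n
  have A: "ok n (A n)" if "0 < n" "good n" for n
    unfolding A_def using that someI_ex[OF ex_ok[OF that]] by presburger
  have "valid_circuit (n + fst (A n)) (snd (A n)) \<and> length (snd (A n)) \<le> t n" for n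
  proof (cases "0 < n \<and> good n")
    case True
    then show ?thesis using A unfolding ok_def by blast
  next
    case False
    then have "A n = (0, [])" unfolding A_def by (rule if_not_P)
    then show ?thesis by simp
  qed
  then have "poly_size_family A" using t unfolding poly_size_family_def by blast
  from hard[OF this] obtain N where N: "\<And>n. N \<le> n \<Longrightarrow> inversion_failure_prob A f n > 1 / real (q n)"
    by (auto simp: eventually_sequentially)
  \<comment> \<open>Good lengths are unbounded, so one lies beyond the threshold \<open>N\<close>
    from which the failure probability is supposed to exceed \<open>1 / q\<close>.\<close>
  obtain n where n: "N < n" "good n"
    using many unfolding good_def[symmetric] INFM_nat by blast
  then have "ok n (A n)" by (intro A) auto
  then have "inversion_failure_prob A f n \<le> 1 / real (q n)"
    by (simp add: ok_def inversion_failure_prob_def output_prob_def case_prod_unfold)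
  with N[of n] n(1) show False by simp
qed

end
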